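(* Let $\phi,\psi$ be meromorphic functions on $\mathbb P$. Then 1. if $D\subset\mathbb P$ is a disc and $\phi,\psi$ are regular along $\partial D$, then ${}_D\Phi\circ{}_D\Psi-{}_D\Psi\circ{}_D\Phi=-\frac{1}{2\pi i}\int_{\partial D}\phi\,d\psi$; 2. for $P\in\mathbb P$, $\Phi_P\circ\Psi_P-\Psi_P\circ\Phi_P=\mathrm{Res}_P(\phi\,d\psi)$; 3. for $O\in\mathbb P$, ${}_O\Phi\circ{}_O\Psi-{}_O\Psi\circ{}_O\Phi=-\mathrm{Res}_O(\phi\,d\psi)$. (The right sides act as scalars.)
   Context: $\mathbb P$ is a complex projective line. $\mathbf K$ is the space of meromorphic 1-forms on $\mathbb P$ with all residues zero, $\mathbf W=S^*\mathbf K$ its symmetric algebra (product $\otimes^s$). A disc $D\subset\mathbb P$ is an open simply connected domain, biholomorphic to a disc, with smooth boundary $\partial D$ oriented counterclockwise around $D$; $D'$ is the complement of its closure. $\mathbf W_{\partial D}$ is the symmetric algebra over the space of forms in $\mathbf K$ regular along $\partial D$. The following operators depend linearly on the function $\phi$; every meromorphic function (in the first case: regular along $\partial D$) is a sum of functions of the two listed types, unique up to constants, and constants act by zero. (a) For $\phi$ regular along $\partial D$, ${}_D\Phi:\mathbf W_{\partial D}\to\mathbf W_{\partial D}$ is $${}_D\Phi[\alpha_1\otimes^s\cdots\otimes^s\alpha_p]=-\sum_i(\alpha_1\otimes^s\cdots\widehat{\alpha_i}\cdots\otimes^s\alpha_p)\,\frac1{2\pi i}\int_{\partial D}\phi\alpha_i+\delta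 ,$$ with $\delta=d\phi\otimes^s\alpha_1\otimes^s\cdots\otimes^s\alpha_p$ if $\phi$ is regular in $D'$, and $\delta=0$ if $\phi$ is regular in $D$. (b) For $\phi$ meromorphic, $\Phi_P:\mathbf W\to\mathbf W$ is $$\Phi_P[\alpha_1\otimes^s\cdots\otimes^s\alpha_p]=\sum_i(\alpha_1\otimes^s\cdots\widehat{\alpha_i}\cdots\otimes^s\alpha_p)\,\mathrm{Res}_P(\phi\alpha_i)+\delta ,$$ with $\delta=d\phi\otimes^s\alpha_1\otimes^s\cdots\otimes^s\alpha_p$ if $\phi$ is regular at $P$, and $\delta=0$ if $\phi$ is regular away from $P$. (c) For $\phi$ meromorphic, ${}_O\Phi:\mathbf W\to\mathbf W$ is $${}_O\Phi[\alpha_1\otimes^s\cdots\otimes^s\alpha_p]=-\sum_i(\alpha_1\otimes^s\cdots\widehat{\alpha_i}\cdots\otimes^s\alpha_p)\,\mathrm{Res}_O(\phi\alpha_i)+\delta ,$$ with $\delta=d\phi\otimes^s\alpha_1\otimes^s\cdots\otimes^s\alpha_p$ if $\phi$ is regular away from $O$, and $\delta=0$ if $\phi$ is regular at $O$. A hat marks an omitted factor. $\Psi$ denotes the analogous operators built from $\psi$. *)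

theory Defs
  imports "HOL-Complex_Analysis.Complex_Analysis" "HOL-Library.Poly_Mapping" "HOL-Library.Multiset"
begin

section \<open>The complex projective line\<close>

text \<open>\<^term>\<open>Some z\<close> is the point with affine coordinate \<open>z\<close>, \<^term>\<open>None\<close> is the point at infinity.\<close>

type_synonym cp1 = "complex option"

definition cp1_topology :: "cp1 topology" where
  "cp1_topology = Alexandroff_compactification euclidean"

text \<open>
  \<open>coord q\<close> is an affine coordinate on the complement of \<open>q\<close> (its value at \<open>q\<close> itself is
  meaningless): \<open>z\<close> if \<open>q\<close> is the point at infinity, and \<open>1 / (z - a)\<close> if \<open>q = Some a\<close>.
\<close>

fun coord :: "cp1 \<Rightarrow> cp1 \<Rightarrow> complex" where
  "coord None (Some z) = z"
| "coord None None = 0"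
| "coord (Some a) (Some z) = 1 / (z - a)"
| "coord (Some a) None = 0"

text \<open>
  \<open>local_param p\<close> is the holomorphic parametrization of a neighbourhood of \<open>p\<close> that sends \<open>0\<close>
  to \<open>p\<close>, with parameter \<open>z - a\<close> at \<open>p = Some a\<close> and \<open>1 / z\<close> at infinity.
\<close>

fun local_param :: "cp1 \<Rightarrow> complex \<Rightarrow> cp1" where
  "local_param (Some a) u = Some (a + u)"
| "local_param None u = (if u = 0 then None else Some (1 / u))"


section \<open>Meromorphic functions and meromorphic 1-forms\<close>

text \<open>
  As for \<^const>\<open>meromorphic_on\<close>, the values of a meromorphic function at its poles and at other
  isolated points are irrelevant; in particular removable singularities count as regular points.
\<close>

definition mero_fun :: "(cp1 \<Rightarrow> complex) \<Rightarrow> bool" where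
  "mero_fun \<phi> \<longleftrightarrow> (\<forall>p. (\<lambda>u. \<phi> (local_param p u)) meromorphic_on {0})"

definition fun_regular_on :: "(cp1 \<Rightarrow> complex) \<Rightarrow> cp1 set \<Rightarrow> bool" where
  "fun_regular_on \<phi> A \<longleftrightarrow> (\<forall>p\<in>A. \<not> is_pole (\<lambda>u. \<phi> (local_param p u)) 0)"

text \<open>
  A 1-form is given by its coefficient \<open>f\<close> in the affine coordinate, i.e. it is \<open>f(z) dz\<close>.
  \<open>form_at f p\<close> is the coefficient in the local parameter \<open>u\<close> at \<open>p\<close>; at infinity \<open>z = 1 / u\<close>
  and \<open>dz = - du / u^2\<close>.
\<close>

fun form_at :: "(complex \<Rightarrow> complex) \<Rightarrow> cp1 \<Rightarrow> complex \<Rightarrow> complex" where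
  "form_at f (Some a) u = f (a + u)"
| "form_at f None u = - f (1 / u) / u ^ 2"

definition mero_form :: "(complex \<Rightarrow> complex) \<Rightarrow> bool" where
  "mero_form f \<longleftrightarrow> (\<forall>p. form_at f p meromorphic_on {0})"

definition form_regular_on :: "(complex \<Rightarrow> complex) \<Rightarrow> cp1 set \<Rightarrow> bool" where
  "form_regular_on f A \<longleftrightarrow> (\<forall>p\<in>A. \<not> is_pole (form_at f p) 0)"

definition Res :: "cp1 \<Rightarrow> (complex \<Rightarrow> complex) \<Rightarrow> complex" where
  "Res p f = residue (form_at f p) 0"

definition dcoeff :: "(cp1 \<Rightarrow> complex) \<Rightarrow> complex \<Rightarrow> complex" where
  "dcoeff \<phi> z = deriv (\<lambda>w. \<phi> (Some w)) z"

definition residue_free :: "(complex \<Rightarrow> complex) \<Rightarrow> bool" where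
  "residue_free f \<longleftrightarrow> mero_form f \<and> (\<forall>p. Res p f = 0)"

definition form_eq :: "(complex \<Rightarrow> complex) \<Rightarrow> (complex \<Rightarrow> complex) \<Rightarrow> bool" where
  "form_eq f g \<longleftrightarrow> residue_free f \<and> residue_free g \<and> (\<forall>z. eventually (\<lambda>x. f x = g x) (at z))"

lemma form_at_add: "form_at (\<lambda>z. f z + g z) p = (\<lambda>u. form_at f p u + form_at g p u)"
  by (cases p) (auto simp: fun_eq_iff field_simps diff_divide_distrib add_divide_distrib)

lemma form_at_cmult: "form_at (\<lambda>z. c * f z) p = (\<lambda>u. c * form_at f p u)"
  by (cases p) (auto simp: fun_eq_iff)

lemma form_at_zero: "form_at (\<lambda>z. 0) p = (\<lambda>u. 0)"
  by (cases p) (auto simp: fun_eq_iff)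

lemma meromorphic_residue_add:
  assumes "f meromorphic_on {0}" "g meromorphic_on {0}"
  shows "residue (\<lambda>u. f u + g u) 0 = residue f 0 + residue g 0"
proof -
  obtain F G where F: "f has_laurent_expansion F" and G: "g has_laurent_expansion G"
    using assms by (auto simp: meromorphic_on_def)
  show ?thesis
    using has_laurent_expansion_residue_0[OF has_laurent_expansion_add[OF F G]]
      has_laurent_expansion_residue_0[OF F] has_laurent_expansion_residue_0[OF G] by simp
qed

lemma meromorphic_residue_cmult:
  assumes "f meromorphic_on {0}"
  shows "residue (\<lambda>u. c * f u) 0 = c * residue f 0"
proof -
  obtain F where F: "f has_laurent_expansion F"
    using assms by (auto simp: meromorphic_on_def)
  show ?thesis
    using has_laurent_expansion_residue_0[OF has_laurent_expansion_cmult_left[OF F]]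
      has_laurent_expansion_residue_0[OF F] by simp
qed

lemma residue_free_add: "residue_free f \<Longrightarrow> residue_free g \<Longrightarrow> residue_free (\<lambda>z. f z + g z)"
  by (auto simp: residue_free_def mero_form_def Res_def form_at_add meromorphic_residue_add
      intro!: meromorphic_intros)

lemma residue_free_cmult: "residue_free f \<Longrightarrow> residue_free (\<lambda>z. c * f z)"
  by (auto simp: residue_free_def mero_form_def Res_def form_at_cmult meromorphic_residue_cmult
      intro!: meromorphic_intros)

lemma residue_free_zero: "residue_free (\<lambda>z. 0)"
  by (auto simp: residue_free_def mero_form_def Res_def form_at_zero residue_const
      intro!: meromorphic_intros)


section \<open>Complex vector spaces\<close>

class complex_vector = ab_group_add +
  fixes cscale :: "complex \<Rightarrow> 'a \<Rightarrow> 'a"  (infixr \<open>*\<^sub>C\<close> 75)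
  assumes cscale_add_right: "c *\<^sub>C (x + y) = c *\<^sub>C x + c *\<^sub>C y"
    and cscale_add_left: "(c + d) *\<^sub>C x = c *\<^sub>C x + d *\<^sub>C x"
    and cscale_cscale: "c *\<^sub>C d *\<^sub>C x = (c * d) *\<^sub>C x"
    and cscale_one: "1 *\<^sub>C x = x"

text \<open>The space \<open>K\<close> of meromorphic 1-forms on the projective line with all residues zero.\<close>

quotient_type kform = "complex \<Rightarrow> complex" / partial: form_eq
proof (rule part_equivpI)
  show "\<exists>f. form_eq f f"
    using residue_free_zero by (auto simp: form_eq_def)
  show "symp form_eq"
    by (auto simp: symp_def form_eq_def eq_commute)
  show "transp form_eq"
  proof (intro transpI)
    fix f g h assume fg: "form_eq f g" and gh: "form_eq g h"
    have "eventually (\<lambda>x. f x = h x) (at z)" for z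
    proof -
      have "eventually (\<lambda>x. f x = g x) (at z)" "eventually (\<lambda>x. g x = h x) (at z)"
        using fg gh by (auto simp: form_eq_def)
      then show ?thesis by eventually_elim simp
    qed
    then show "form_eq f h" using fg gh by (auto simp: form_eq_def)
  qed
qed

instantiation kform :: complex_vector
begin

lift_definition zero_kform :: kform is "\<lambda>z. 0"
  by (simp add: form_eq_def residue_free_zero)

lift_definition plus_kform :: "kform \<Rightarrow> kform \<Rightarrow> kform" is "\<lambda>f g z. f z + g z"
proof -
  fix f f' g g' assume eqs: "form_eq f f'" "form_eq g g'"
  have "eventually (\<lambda>x. f x + g x = f' x + g' x) (at z)" for z
  proof -
    have "eventually (\<lambda>x. f x = f' x) (at z)" "eventually (\<lambda>x. g x = g' x) (at z)"
      using eqs by (auto simp: form_eq_def)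
    then show ?thesis by eventually_elim simp
  qed
  then show "form_eq (\<lambda>z. f z + g z) (\<lambda>z. f' z + g' z)"
    using eqs by (auto simp: form_eq_def intro!: residue_free_add)
qed

lift_definition cscale_kform :: "complex \<Rightarrow> kform \<Rightarrow> kform" is "\<lambda>c f z. c * f z"
  unfolding form_eq_def by (auto intro!: residue_free_cmult elim: eventually_mono)

definition uminus_kform :: "kform \<Rightarrow> kform" where
  "uminus_kform \<alpha> = (-1) *\<^sub>C \<alpha>"

definition minus_kform :: "kform \<Rightarrow> kform \<Rightarrow> kform" where
  "minus_kform \<alpha> \<beta> = \<alpha> + (- \<beta>)"

instance
proof
  fix \<alpha> \<beta> \<gamma> :: kform and c d :: complex
  note lin = residue_free_add residue_free_cmult residue_free_zero
  show "\<alpha> + \<beta> + \<gamma> = \<alpha> + (\<beta> + \<gamma>)"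
    by transfer (auto simp: form_eq_def add.assoc intro!: lin)
  show "\<alpha> + \<beta> = \<beta> + \<alpha>"
    by transfer (auto simp: form_eq_def add.commute intro!: lin)
  show "0 + \<alpha> = \<alpha>"
    by transfer (auto simp: form_eq_def)
  show "- \<alpha> + \<alpha> = 0"
    unfolding uminus_kform_def
    by transfer (auto simp: form_eq_def intro!: lin residue_free_add[of "\<lambda>z. - f z" f for f]
        dest: residue_free_cmult[of _ "-1"])
  show "\<alpha> - \<beta> = \<alpha> + (- \<beta>)"
    by (simp add: minus_kform_def)
  show "c *\<^sub>C (\<alpha> + \<beta>) = c *\<^sub>C \<alpha> + c *\<^sub>C \<beta>"
    by transfer (auto simp: form_eq_def algebra_simps intro!: lin)
  show "(c + d) *\<^sub>C \<alpha> = c *\<^sub>C \<alpha> + d *\<^sub>C \<alpha>"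
    by transfer (auto simp: form_eq_def algebra_simps intro!: lin)
  show "c *\<^sub>C d *\<^sub>C \<alpha> = (c * d) *\<^sub>C \<alpha>"
    by transfer (auto simp: form_eq_def mult.assoc intro!: lin)
  show "1 *\<^sub>C \<alpha> = \<alpha>"
    by transfer (auto simp: form_eq_def)
qed

end

text \<open>
  \<^term>\<open>rep_kform \<alpha>\<close> is a coefficient function of \<open>\<alpha>\<close>, unique up to its values on a discrete set;
  poles, residues and integrals of forms do not see this ambiguity.
\<close>

definition d_kform :: "(cp1 \<Rightarrow> complex) \<Rightarrow> kform" where
  "d_kform \<phi> = abs_kform (dcoeff \<phi>)"

definition fun_times_form :: "(cp1 \<Rightarrow> complex) \<Rightarrow> (complex \<Rightarrow> complex) \<Rightarrow> complex \<Rightarrow> complex" where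
  "fun_times_form \<phi> f z = \<phi> (Some z) * f z"

definition kforms_regular_on :: "cp1 set \<Rightarrow> kform set" where
  "kforms_regular_on A = {\<alpha>. form_regular_on (rep_kform \<alpha>) A}"


section \<open>Symmetric algebras\<close>

text \<open>
  \<^typ>\<open>'v multiset \<Rightarrow>\<^sub>0 complex\<close> is the free commutative algebra on the set of all vectors.
  The symmetric algebra is its quotient by the ideal generated by the linear relations.
\<close>

definition free_gen :: "'v \<Rightarrow> 'v multiset \<Rightarrow>\<^sub>0 complex" where
  "free_gen v = Poly_Mapping.single {#v#} 1"

definition free_const :: "complex \<Rightarrow> 'v multiset \<Rightarrow>\<^sub>0 complex" where
  "free_const c = Poly_Mapping.single {#} c"

definition sym_relations :: "('v::complex_vector multiset \<Rightarrow>\<^sub>0 complex) set" where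
  "sym_relations =
     {free_gen (v + w) - (free_gen v + free_gen w) | v w. True} \<union>
     {free_gen (c *\<^sub>C v) - free_const c * free_gen v | c v. True}"

definition sym_ideal :: "('v::complex_vector multiset \<Rightarrow>\<^sub>0 complex) set" where
  "sym_ideal = module.span (*) sym_relations"

lemma lookup_free_mult_empty:
  fixes a b :: "'v multiset \<Rightarrow>\<^sub>0 complex"
  shows "Poly_Mapping.lookup (a * b) {#} = Poly_Mapping.lookup a {#} * Poly_Mapping.lookup b {#}"
proof -
  have inner: "(\<Sum>q. Poly_Mapping.lookup b q when {#} = l + q) =
      (Poly_Mapping.lookup b {#} when l = {#})" for l :: "'v multiset"
  proof (cases "l = {#}")
    case True
    then have "(\<lambda>q. Poly_Mapping.lookup b q when {#} = l + q) =
        (\<lambda>q. Poly_Mapping.lookup b q when q = {#})"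
      by (auto simp: when_def)
    with True show ?thesis by simp
  qed simp
  have "Poly_Mapping.lookup (a * b) {#} =
      (\<Sum>l. Poly_Mapping.lookup a l * (Poly_Mapping.lookup b {#} when l = {#}))"
    unfolding times_poly_mapping.rep_eq prod_fun_def inner ..
  then show ?thesis by (simp add: mult_when)
qed

lemma module_mult: "module ((*) :: 'a::comm_ring_1 \<Rightarrow> 'a \<Rightarrow> 'a)"
  by unfold_locales (auto simp: algebra_simps)

lemma sym_ideal_zero: "0 \<in> sym_ideal"
  unfolding sym_ideal_def by (rule module.span_zero[OF module_mult])

lemma sym_ideal_add: "x \<in> sym_ideal \<Longrightarrow> y \<in> sym_ideal \<Longrightarrow> x + y \<in> sym_ideal"
  unfolding sym_ideal_def by (rule module.span_add[OF module_mult])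

lemma sym_ideal_uminus: "x \<in> sym_ideal \<Longrightarrow> - x \<in> sym_ideal"
  unfolding sym_ideal_def by (rule module.span_neg[OF module_mult])

lemma sym_ideal_mult: "x \<in> sym_ideal \<Longrightarrow> a * x \<in> sym_ideal"
  unfolding sym_ideal_def by (rule module.span_scale[OF module_mult])

lemma sym_ideal_one: "(1 :: 'v::complex_vector multiset \<Rightarrow>\<^sub>0 complex) \<notin> sym_ideal"
proof -
  let ?I = "{x :: 'v multiset \<Rightarrow>\<^sub>0 complex. Poly_Mapping.lookup x {#} = 0}"
  have "module.subspace (*) ?I"
    unfolding module.subspace_def[OF module_mult]
    by (auto simp: lookup_add lookup_free_mult_empty)
  moreover have "sym_relations \<subseteq> ?I"
    by (auto simp: sym_relations_def free_gen_def lookup_add lookup_minus lookup_single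
        lookup_free_mult_empty)
  ultimately have "sym_ideal \<subseteq> ?I"
    unfolding sym_ideal_def by (intro module.span_minimal[OF module_mult])
  then show ?thesis by (auto simp: lookup_one)
qed

definition sym_eq where
  "sym_eq x y \<longleftrightarrow> x - y \<in> (sym_ideal :: ('v::complex_vector multiset \<Rightarrow>\<^sub>0 complex) set)"

quotient_type (overloaded) 'v symalg = "'v::complex_vector multiset \<Rightarrow>\<^sub>0 complex" / sym_eq
proof (rule equivpI)
  show "reflp (sym_eq :: ('v multiset \<Rightarrow>\<^sub>0 complex) \<Rightarrow> _)"
    by (simp add: reflp_def sym_eq_def sym_ideal_zero)
  show "symp (sym_eq :: ('v multiset \<Rightarrow>\<^sub>0 complex) \<Rightarrow> _)"
    unfolding symp_def sym_eq_def using sym_ideal_uminus by (metis minus_diff_eq)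
  show "transp (sym_eq :: ('v multiset \<Rightarrow>\<^sub>0 complex) \<Rightarrow> _)"
    unfolding transp_def sym_eq_def using sym_ideal_add by (metis diff_add_cancel add_diff_eq)
qed

instantiation symalg :: (complex_vector) comm_ring_1
begin

lift_definition zero_symalg :: "'a symalg" is 0 .
lift_definition one_symalg :: "'a symalg" is 1 .

lift_definition plus_symalg :: "'a symalg \<Rightarrow> 'a symalg \<Rightarrow> 'a symalg" is "(+)"
  unfolding sym_eq_def using sym_ideal_add by (metis add_diff_add)

lift_definition uminus_symalg :: "'a symalg \<Rightarrow> 'a symalg" is uminus
  unfolding sym_eq_def using sym_ideal_uminus by (metis minus_diff_minus)

lift_definition minus_symalg :: "'a symalg \<Rightarrow> 'a symalg \<Rightarrow> 'a symalg" is "(-)"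
proof -
  fix a b c d :: "'a multiset \<Rightarrow>\<^sub>0 complex"
  assume "sym_eq a b" "sym_eq c d"
  then have "(a - b) + - (c - d) \<in> sym_ideal"
    unfolding sym_eq_def by (intro sym_ideal_add sym_ideal_uminus)
  then show "sym_eq (a - c) (b - d)"
    by (simp add: sym_eq_def algebra_simps)
qed

lift_definition times_symalg :: "'a symalg \<Rightarrow> 'a symalg \<Rightarrow> 'a symalg" is "(*)"
proof -
  fix a b c d :: "'a multiset \<Rightarrow>\<^sub>0 complex"
  assume "sym_eq a b" "sym_eq c d"
  then have "c * (a - b) + b * (c - d) \<in> sym_ideal"
    unfolding sym_eq_def by (intro sym_ideal_add sym_ideal_mult)
  then show "sym_eq (a * c) (b * d)"
    by (simp add: sym_eq_def algebra_simps)
qed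

instance
proof
  fix a b c :: "'a symalg"
  have refl: "sym_eq x x" for x :: "'a multiset \<Rightarrow>\<^sub>0 complex"
    by (simp add: sym_eq_def sym_ideal_zero)
  show "a + b + c = a + (b + c)" by transfer (simp add: refl add.assoc)
  show "a + b = b + a" by transfer (simp add: refl add.commute)
  show "0 + a = a" by transfer (simp add: refl)
  show "- a + a = 0" by transfer (simp add: refl)
  show "a - b = a + - b" by transfer (simp add: refl)
  show "a * b * c = a * (b * c)" by transfer (simp add: refl mult.assoc)
  show "a * b = b * a" by transfer (simp add: refl mult.commute)
  show "1 * a = a" by transfer (simp add: refl)
  show "(a + b) * c = a * c + b * c" by transfer (simp add: refl distrib_right)
  show "(0 :: 'a symalg) \<noteq> 1"
  proof transfer
    show "\<not> sym_eq (0 :: 'a multiset \<Rightarrow>\<^sub>0 complex) 1"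
      using sym_ideal_uminus[of "-1"] sym_ideal_one by (auto simp: sym_eq_def)
  qed
qed

end

lift_definition sym_const :: "complex \<Rightarrow> 'v::complex_vector symalg" is free_const .

lift_definition sym_gen :: "'v::complex_vector \<Rightarrow> 'v symalg" is free_gen .

lemma sym_const_add: "sym_const (c + d) = sym_const c + sym_const d"
  by transfer (simp add: sym_eq_def free_const_def single_add sym_ideal_zero)

lemma sym_const_mult: "sym_const (c * d) = sym_const c * sym_const d"
  by transfer (simp add: sym_eq_def free_const_def mult_single sym_ideal_zero)

lemma sym_const_one: "sym_const 1 = 1"
  by transfer (simp add: sym_eq_def free_const_def sym_ideal_zero)

instantiation symalg :: (complex_vector) complex_vector
begin

definition cscale_symalg :: "complex \<Rightarrow> 'a symalg \<Rightarrow> 'a symalg" where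
  "c *\<^sub>C x = sym_const c * x"

instance
  by standard
    (simp_all add: cscale_symalg_def sym_const_add sym_const_mult sym_const_one algebra_simps)

end

type_synonym W = "kform symalg"

definition sym_prod :: "'v::complex_vector list \<Rightarrow> 'v symalg" where
  "sym_prod vs = prod_list (map sym_gen vs)"

text \<open>
  For a linear subspace \<open>V\<close>, the symmetric algebra of \<open>V\<close>, viewed inside the symmetric algebra of
  the whole space.
\<close>

definition symalg_on :: "'v::complex_vector set \<Rightarrow> 'v symalg set" where
  "symalg_on V = module.span cscale {sym_prod vs | vs. set vs \<subseteq> V}"


section \<open>Discs and their oriented boundaries\<close>

definition simply_connected_in_cp1 :: "cp1 set \<Rightarrow> bool" where
  "simply_connected_in_cp1 D \<longleftrightarrow>
     path_connectedin cp1_topology D \<and>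
     (\<forall>g. pathin (subtopology cp1_topology D) g \<and> g 0 = g 1 \<longrightarrow>
        (\<exists>c. homotopic_with (\<lambda>h. h 0 = h 1) (top_of_set {0..1}) (subtopology cp1_topology D)
               g (\<lambda>_. c)))"

definition biholomorphic_to_unit_disc :: "cp1 set \<Rightarrow> bool" where
  "biholomorphic_to_unit_disc D \<longleftrightarrow>
     (\<exists>h k. bij_betw h (ball 0 1) D \<and> (\<forall>z\<in>ball 0 1. k (h z) = z) \<and>
        continuous_map (top_of_set (ball 0 1)) cp1_topology h \<and>
        (\<forall>q. (\<lambda>z. coord q (h z)) holomorphic_on {z \<in> ball 0 1. h z \<noteq> q}) \<and>
        (\<forall>p\<in>D. (\<lambda>u. k (local_param p u)) analytic_on {0}))"

definition smooth_on :: "real set \<Rightarrow> (real \<Rightarrow> complex) \<Rightarrow> bool" where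
  "smooth_on U c \<longleftrightarrow>
     (\<forall>n. (((\<lambda>g t. vector_derivative g (at t)) ^^ n) c) differentiable_on U)"

definition smooth_regular_curve :: "(real \<Rightarrow> cp1) \<Rightarrow> bool" where
  "smooth_regular_curve \<gamma> \<longleftrightarrow>
     (\<forall>t. \<exists>q U. open U \<and> t \<in> U \<and> (\<forall>s\<in>U. \<gamma> s \<noteq> q) \<and> smooth_on U (\<lambda>s. coord q (\<gamma> s)) \<and>
        vector_derivative (\<lambda>s. coord q (\<gamma> s)) (at t) \<noteq> 0)"

definition smooth_boundary_param :: "cp1 set \<Rightarrow> (real \<Rightarrow> cp1) \<Rightarrow> bool" where
  "smooth_boundary_param D \<gamma> \<longleftrightarrow>
     smooth_regular_curve \<gamma> \<and> (\<forall>t. \<gamma> (t + 1) = \<gamma> t) \<and> inj_on \<gamma> {0..<1} \<and>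
     \<gamma> ` {0..1} = cp1_topology frontier_of D"

definition opposite_disc :: "cp1 set \<Rightarrow> cp1 set" where
  "opposite_disc D = - (cp1_topology closure_of D)"

definition disc :: "cp1 set \<Rightarrow> bool" where
  "disc D \<longleftrightarrow> openin cp1_topology D \<and> simply_connected_in_cp1 D \<and>
     biholomorphic_to_unit_disc D \<and> (\<exists>\<gamma>. smooth_boundary_param D \<gamma>)"

text \<open>
  Counterclockwise around \<open>D\<close>: in an affine coordinate on the complement of a point \<open>q\<close> outside the
  closure of \<open>D\<close>, which makes \<open>D\<close> a bounded plane domain, the curve winds once around the points
  of \<open>D\<close> in the positive sense.
\<close>

definition oriented_boundary :: "cp1 set \<Rightarrow> (real \<Rightarrow> cp1) \<Rightarrow> bool" where
  "oriented_boundary D \<gamma> \<longleftrightarrow> smooth_boundary_param D \<gamma> \<and>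
     (\<exists>q\<in>opposite_disc D. \<forall>p\<in>D. winding_number (\<lambda>t. coord q (\<gamma> t)) (coord q p) = 1)"

text \<open>
  The integral of the form \<open>f(z) dz\<close> along \<open>\<gamma>\<close>, in the affine coordinate.  A simple closed curve
  meets infinity for at most one parameter in \<open>[0, 1)\<close>; for a form regular along the curve
  the integrand \<open>f(z(t)) z'(t)\<close> is bounded near that parameter, which therefore does not contribute.
\<close>

definition form_integral :: "(real \<Rightarrow> cp1) \<Rightarrow> (complex \<Rightarrow> complex) \<Rightarrow> complex" where
  "form_integral \<gamma> f = contour_integral (\<lambda>t. coord None (\<gamma> t)) f"


section \<open>The operators\<close>

definition linear_on_symalg :: "W set \<Rightarrow> (W \<Rightarrow> W) \<Rightarrow> bool" where
  "linear_on_symalg S T \<longleftrightarrow> (\<forall>x\<in>S. \<forall>y\<in>S. T (x + y) = T x + T y) \<and>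
     (\<forall>c. \<forall>x\<in>S. T (c *\<^sub>C x) = c *\<^sub>C T x)"

text \<open>
  The linear operator on the symmetric algebra of \<open>V\<close> (made zero outside) sending
  \<open>\<alpha>_1 \<dots> \<alpha>_p\<close> to the sum of the \<open>c(\<alpha>_i) \<alpha>_1 \<dots> (omit \<alpha>_i) \<dots> \<alpha>_p\<close> plus \<open>\<beta> \<alpha>_1 \<dots> \<alpha>_p\<close>.
\<close>

definition symalg_operator :: "kform set \<Rightarrow> (kform \<Rightarrow> complex) \<Rightarrow> kform \<Rightarrow> W \<Rightarrow> W" where
  "symalg_operator V c \<beta> =
     (THE T. linear_on_symalg (symalg_on V) T \<and> T ` symalg_on V \<subseteq> symalg_on V \<and>
        (\<forall>x. x \<notin> symalg_on V \<longrightarrow> T x = 0) \<and>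
        (\<forall>\<alpha>s. set \<alpha>s \<subseteq> V \<longrightarrow>
           T (sym_prod \<alpha>s) =
             (\<Sum>i<length \<alpha>s. c (\<alpha>s ! i) *\<^sub>C sym_prod (take i \<alpha>s @ drop (Suc i) \<alpha>s))
             + sym_gen \<beta> * sym_prod \<alpha>s))"

text \<open>
  \<open>op1 \<phi>1\<close> and \<open>op2 \<phi>2\<close> are the operators for functions of the two types, those regular on \<open>A1\<close>
  and those regular on \<open>A2\<close>; a general function is split as a sum of one of each type.
\<close>

definition split_operator ::
  "cp1 set \<Rightarrow> cp1 set \<Rightarrow> ((cp1 \<Rightarrow> complex) \<Rightarrow> W \<Rightarrow> W) \<Rightarrow> ((cp1 \<Rightarrow> complex) \<Rightarrow> W \<Rightarrow> W) \<Rightarrow>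
     (cp1 \<Rightarrow> complex) \<Rightarrow> W \<Rightarrow> W" where
  "split_operator A1 A2 op1 op2 \<phi> =
     (THE T. \<exists>\<phi>1 \<phi>2. mero_fun \<phi>1 \<and> fun_regular_on \<phi>1 A1 \<and> mero_fun \<phi>2 \<and> fun_regular_on \<phi>2 A2 \<and>
        (\<forall>p. \<phi> p = \<phi>1 p + \<phi>2 p) \<and> (\<forall>x. T x = op1 \<phi>1 x + op2 \<phi>2 x))"

definition W_boundary :: "cp1 set \<Rightarrow> W set" where
  "W_boundary D = symalg_on (kforms_regular_on (cp1_topology frontier_of D))"

text \<open>\<open>\<gamma>\<close> is the oriented boundary of \<open>D\<close> in the following definitions.\<close>

definition boundary_coeff :: "(real \<Rightarrow> cp1) \<Rightarrow> (cp1 \<Rightarrow> complex) \<Rightarrow> kform \<Rightarrow> complex" where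
  "boundary_coeff \<gamma> \<phi> \<alpha> =
     - (1 / (2 * pi * \<i>) * form_integral \<gamma> (fun_times_form \<phi> (rep_kform \<alpha>)))"

definition Phi_disc :: "cp1 set \<Rightarrow> (real \<Rightarrow> cp1) \<Rightarrow> (cp1 \<Rightarrow> complex) \<Rightarrow> W \<Rightarrow> W" where
  "Phi_disc D \<gamma> =
     (let F = cp1_topology frontier_of D; V = kforms_regular_on F in
      split_operator (opposite_disc D \<union> F) (D \<union> F)
        (\<lambda>\<phi>. symalg_operator V (boundary_coeff \<gamma> \<phi>) (d_kform \<phi>))
        (\<lambda>\<phi>. symalg_operator V (boundary_coeff \<gamma> \<phi>) 0))"

definition Phi_right :: "cp1 \<Rightarrow> (cp1 \<Rightarrow> complex) \<Rightarrow> W \<Rightarrow> W" where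
  "Phi_right P =
     (let c = (\<lambda>\<phi> \<alpha>. Res P (fun_times_form \<phi> (rep_kform \<alpha>))) in
      split_operator {P} (- {P})
        (\<lambda>\<phi>. symalg_operator UNIV (c \<phi>) (d_kform \<phi>))
        (\<lambda>\<phi>. symalg_operator UNIV (c \<phi>) 0))"

definition Phi_left :: "cp1 \<Rightarrow> (cp1 \<Rightarrow> complex) \<Rightarrow> W \<Rightarrow> W" where
  "Phi_left Q =
     (let c = (\<lambda>\<phi> \<alpha>. - Res Q (fun_times_form \<phi> (rep_kform \<alpha>))) in
      split_operator (- {Q}) {Q}
        (\<lambda>\<phi>. symalg_operator UNIV (c \<phi>) (d_kform \<phi>))
        (\<lambda>\<phi>. symalg_operator UNIV (c \<phi>) 0))"

end

theory Submission
  imports Defs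
begin

text \<open>
  Let \<open>J\<close> be one of the functionals \<open>-1/(2 \<pi> i) \<integral>\<close>, \<open>Res_P\<close>, \<open>-Res_O\<close> on 1-forms. In all three cases there are
  two sets \<open>A1\<close>, \<open>A2\<close> covering the projective line such that \<open>\<phi> = \<phi>1 + \<phi>2\<close> with \<open>\<phi>1\<close> regular on \<open>A1\<close> and
  \<open>\<phi>2\<close> regular on \<open>A2\<close>, and the operator attached to \<open>\<phi>\<close> is \<open>x \<mapsto> \<delta> x + d\<phi>1 \<cdot> x\<close>, where \<open>\<delta>\<close> is the derivation
  of the symmetric algebra that contracts a generator \<open>\<alpha>\<close> to the scalar \<open>J(\<phi> \<alpha>)\<close>. Two such derivations
  commute, because both kill scalars, and a derivation and a multiplication by a generator commute up to
  the contraction of that generator. Hence the commutator is the scalar \<open>J(\<phi> d\<psi>1) - J(\<psi> d\<phi>1)\<close>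
  (\<open>commutator_derivation_plus_multiplication\<close>).

  This scalar equals \<open>J(\<phi> d\<psi>)\<close> because \<open>J\<close> is linear, does not see the values
  of a coefficient function at finitely many points, and vanishes on forms regular on \<open>A1\<close> and on
  forms regular on \<open>A2\<close>. Splitting a function \<open>\<theta>\<close> shows \<open>J(d\<theta>) =
  0\<close>, so that \<open>J(\<phi> d\<psi>)\<close> is antisymmetric by the Leibniz rule; moreover
  \<open>J(\<phi>1 d\<psi>1) = J(\<phi>2 d\<psi>2) = 0\<close>. Therefore \<open>J(\<phi> d\<psi>) = J(\<phi>1
  d\<psi>2) + J(\<phi>2 d\<psi>1)\<close>, while \<open>J(\<phi> d\<psi>1) = J(\<phi>2 d\<psi>1)\<close> and
  \<open>J(\<psi> d\<phi>1) = J(\<psi>2 d\<phi>1) = - J(\<phi>1 d\<psi>2)\<close>. The locale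
  \<open>residue_pairing\<close> isolates this argument, so that the three statements differ only in the
  verification of the hypotheses on \<open>J\<close>.

  The geometry enters in four places. Principal parts split every function (\<open>ex_splitting\<close>). By
  Liouville's theorem two splittings differ by a constant, off finitely many points, so that
  \<open>d\<phi>1\<close> and the operator are well defined (\<open>splitting_unique\<close>). A form regular away
  from \<open>P\<close> has residue zero at \<open>P\<close>, since it has a primitive in an affine coordinate
  with pole \<open>P\<close> (\<open>Res_regular_away\<close>). Finally, the integral along
  \<open>\<partial>D\<close> of a form regular on the closure of \<open>D\<close>, or on the closure of
  \<open>D'\<close>, vanishes by Cauchy's theorem in an affine coordinate whose pole lies on the other side: the
  winding numbers around the other side vanish, by the Jordan curve theorem for a pole in \<open>D'\<close> and by
  a change of pole for a pole in \<open>D\<close> (\<open>boundary_integral_zero\<close>).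
\<close>


section \<open>Contractions of symmetric algebras\<close>

lemma vector_space_cscale: "vector_space (cscale :: complex \<Rightarrow> 'v::complex_vector \<Rightarrow> 'v)"
  by unfold_locales (simp_all add: cscale_add_right cscale_add_left cscale_cscale cscale_one)

lemma cscale_zero_left: "0 *\<^sub>C (v :: 'v::complex_vector) = 0"
  using cscale_add_left[of 0 0 v] by simp

lemma cscale_mult_symalg:
  fixes x y :: "'v::complex_vector symalg"
  shows "(c *\<^sub>C x) * y = c *\<^sub>C (x * y)" and "x * (c *\<^sub>C y) = c *\<^sub>C (x * y)"
  by (simp_all add: cscale_symalg_def algebra_simps)

definition sym_monomial :: "'v::complex_vector multiset \<Rightarrow> 'v symalg" where
  "sym_monomial m = prod_mset (image_mset sym_gen m)"

definition contract_monomial ::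
  "('v::complex_vector \<Rightarrow> complex) \<Rightarrow> 'v multiset \<Rightarrow> 'v symalg" where
  "contract_monomial d m = (\<Sum>v\<in>#m. d v *\<^sub>C sym_monomial (m - {#v#}))"

text \<open>
  The linear extension to the free algebra of a map given on monomials. Contractions are built on the free
  algebra first and shown to kill the ideal of linear relations afterwards.
\<close>

definition linear_eval ::
  "('v::complex_vector multiset \<Rightarrow> 'v symalg) \<Rightarrow> ('v multiset \<Rightarrow>\<^sub>0 complex) \<Rightarrow> 'v symalg" where
  "linear_eval f x = (\<Sum>m\<in>Poly_Mapping.keys x. Poly_Mapping.lookup x m *\<^sub>C f m)"

lemma sym_monomial_union: "sym_monomial (m + n) = sym_monomial m * sym_monomial n"
  by (simp add: sym_monomial_def)

lemma contract_monomial_add_mset: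
  "contract_monomial d (add_mset v m) =
     d v *\<^sub>C sym_monomial m + sym_gen v * contract_monomial d m"
proof -
  have "(\<Sum>w\<in>#m. d w *\<^sub>C sym_monomial (add_mset v m - {#w#})) =
      (\<Sum>w\<in>#m. sym_gen v * (d w *\<^sub>C sym_monomial (m - {#w#})))"
  proof (intro arg_cong[of _ _ sum_mset] image_mset_cong)
    fix w assume "w \<in># m"
    then have "add_mset v m - {#w#} = add_mset v (m - {#w#})"
      by (metis add_mset_commute add_mset_remove_trivial multi_member_split)
    then show "d w *\<^sub>C sym_monomial (add_mset v m - {#w#}) =
        sym_gen v * (d w *\<^sub>C sym_monomial (m - {#w#}))"
      by (simp add: sym_monomial_def cscale_mult_symalg)
  qed
  then show ?thesis
    by (simp add: contract_monomial_def sum_mset_distrib_left)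
qed

lemma contract_monomial_union:
  "contract_monomial d (m + n) =
     sym_monomial m * contract_monomial d n + sym_monomial n * contract_monomial d m"
proof (induction m)
  case empty
  then show ?case by (simp add: contract_monomial_def sym_monomial_def)
next
  case (add v m)
  have "contract_monomial d (add_mset v m + n) =
      d v *\<^sub>C (sym_monomial m * sym_monomial n) +
      sym_gen v * (sym_monomial m * contract_monomial d n + sym_monomial n * contract_monomial d m)"
    using add by (simp add: contract_monomial_add_mset sym_monomial_union)
  then show ?case
    by (simp add: contract_monomial_add_mset sym_monomial_def algebra_simps cscale_mult_symalg)
qed

lemma linear_eval_superset:
  assumes "finite K" "Poly_Mapping.keys x \<subseteq> K"
  shows "linear_eval f x = (\<Sum>m\<in>K. Poly_Mapping.lookup x m *\<^sub>C f m)"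
  unfolding linear_eval_def using assms
  by (intro sum.mono_neutral_left)
    (auto simp: in_keys_iff cscale_zero_left)

lemma linear_eval_add: "linear_eval f (x + y) = linear_eval f x + linear_eval f y"
proof -
  let ?K = "Poly_Mapping.keys x \<union> Poly_Mapping.keys y"
  have "linear_eval f z = (\<Sum>m\<in>?K. Poly_Mapping.lookup z m *\<^sub>C f m)"
    if "z \<in> {x, y, x + y}" for z
    using that Poly_Mapping.keys_add[of x y] by (intro linear_eval_superset) auto
  then show ?thesis
    by (simp add: lookup_add cscale_add_left sum.distrib)
qed

lemma linear_eval_diff: "linear_eval f (x - y) = linear_eval f x - linear_eval f y"
  using linear_eval_add[of f "x - y" y] by (simp add: algebra_simps)

lemma linear_eval_single: "linear_eval f (Poly_Mapping.single m a) = a *\<^sub>C f m"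
  by (subst linear_eval_superset[of "{m}"]) (auto simp: lookup_single)

lemma free_induct [case_names single add]:
  fixes x :: "'v multiset \<Rightarrow>\<^sub>0 complex"
  assumes "\<And>m a. P (Poly_Mapping.single m a)" "\<And>x y. P x \<Longrightarrow> P y \<Longrightarrow> P (x + y)"
  shows "P x"
proof (induction x rule: Poly_Mapping.update_induct)
  case const
  then show ?case using assms(1)[of "{#}" 0] by simp
next
  case (update f a b)
  have "Poly_Mapping.update a b f = f + Poly_Mapping.single a b"
    using update by (intro poly_mapping_eqI)
      (auto simp: lookup_update lookup_add lookup_single in_keys_iff when_def)
  then show ?case using assms update by simp
qed

lemma abs_symalg_add: "abs_symalg (x + y) = abs_symalg x + abs_symalg y"
  by (simp add: plus_symalg.abs_eq)

lemma abs_symalg_eq_linear_eval: "abs_symalg x = linear_eval sym_monomial x"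
proof (induction x rule: free_induct)
  case (single m a)
  have "abs_symalg (Poly_Mapping.single m 1) = sym_monomial m"
  proof (induction m)
    case empty
    then show ?case by (simp add: sym_monomial_def one_symalg.abs_eq flip: single_one)
  next
    case (add v m)
    have "Poly_Mapping.single (add_mset v m) 1 =
        (free_gen v * Poly_Mapping.single m 1 :: 'a multiset \<Rightarrow>\<^sub>0 complex)"
      by (simp add: free_gen_def mult_single)
    then show ?case
      using add by (simp add: sym_monomial_def sym_gen.abs_eq flip: times_symalg.abs_eq)
  qed
  moreover have "Poly_Mapping.single m a =
      (free_const a * Poly_Mapping.single m 1 :: 'a multiset \<Rightarrow>\<^sub>0 complex)"
    by (simp add: free_const_def mult_single)
  then have "abs_symalg (Poly_Mapping.single m a) =
      sym_const a * abs_symalg (Poly_Mapping.single m 1)"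
    by (simp only: sym_const.abs_eq times_symalg.abs_eq)
  ultimately show ?case
    by (simp add: linear_eval_single cscale_symalg_def)
qed (simp add: abs_symalg_add linear_eval_add)

text \<open>
  The Leibniz rule, with the coefficients already in the quotient. In this form it shows at once that the
  contraction annihilates the whole ideal as soon as it annihilates the relations generating it.
\<close>

lemma free_contraction_mult:
  "linear_eval (contract_monomial d) (x * y) =
     abs_symalg x * linear_eval (contract_monomial d) y +
     abs_symalg y * linear_eval (contract_monomial d) x"
proof (induction x rule: free_induct)
  case (single m a)
  show ?case
  proof (induction y rule: free_induct)
    case (single n b)
    then show ?case
      by (simp add: mult_single linear_eval_single abs_symalg_eq_linear_eval
          contract_monomial_union cscale_mult_symalg cscale_add_right cscale_cscale mult.commute)
  qed (simp add: distrib_left linear_eval_add abs_symalg_add algebra_simps)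
qed (simp add: distrib_right linear_eval_add abs_symalg_add algebra_simps)

lemma free_contraction_gen:
  "linear_eval (contract_monomial d) (free_gen v) = sym_const (d v)"
  by (simp add: free_gen_def linear_eval_single contract_monomial_def sym_monomial_def
      cscale_one) (simp add: cscale_symalg_def)

lemma free_contraction_const: "linear_eval (contract_monomial d) (free_const a) = 0"
  by (simp add: free_const_def linear_eval_single contract_monomial_def cscale_symalg_def)

definition linear_functional :: "('v::complex_vector \<Rightarrow> complex) \<Rightarrow> bool" where
  "linear_functional d \<longleftrightarrow>
     (\<forall>v w. d (v + w) = d v + d w) \<and> (\<forall>a v. d (a *\<^sub>C v) = a * d v)"

text \<open>
  The Leibniz rule is required for products with one generator only; with linearity and \<open>\<delta> 1 = 0\<close>
  this determines \<open>\<delta>\<close>.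
\<close>

definition sym_derivation ::
  "('v::complex_vector \<Rightarrow> complex) \<Rightarrow> ('v symalg \<Rightarrow> 'v symalg) \<Rightarrow> bool" where
  "sym_derivation d \<delta> \<longleftrightarrow>
     (\<forall>x y. \<delta> (x + y) = \<delta> x + \<delta> y) \<and> (\<forall>a x. \<delta> (a *\<^sub>C x) = a *\<^sub>C \<delta> x) \<and> \<delta> 1 = 0 \<and>
     (\<forall>v x. \<delta> (sym_gen v * x) = d v *\<^sub>C x + sym_gen v * \<delta> x)"

text \<open>
  Linearity of \<open>d\<close> is exactly what makes the contraction vanish on the relations. The set of elements that
  are zero in the quotient and have zero contraction is an ideal by the Leibniz rule.
\<close>

lemma contraction_sym_ideal:
  assumes d: "linear_functional d" and x: "x \<in> sym_ideal"
  shows "linear_eval (contract_monomial d) x = 0"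
proof -
  let ?E = "linear_eval (contract_monomial d)"
  have rel: "?E r = 0" if "r \<in> sym_relations" for r
    using that d by (auto simp: sym_relations_def linear_eval_diff free_contraction_gen free_contraction_const linear_eval_add free_contraction_mult
        linear_functional_def sym_const_add sym_const_mult simp flip: sym_const.abs_eq)
  have rel0: "abs_symalg r = 0" if "r \<in> sym_relations" for r
    using that module.span_base[OF module_mult that]
    by (simp add: zero_symalg.abs_eq symalg.abs_eq_iff sym_eq_def sym_ideal_def)
  have "x \<in> {x. abs_symalg x = 0 \<and> ?E x = 0}"
  proof (rule subsetD[OF module.span_minimal[OF module_mult] x[unfolded sym_ideal_def]])
    show "sym_relations \<subseteq> {x. abs_symalg x = 0 \<and> ?E x = 0}" using rel rel0 by auto
    show "module.subspace (*) {x. abs_symalg x = 0 \<and> ?E x = 0}"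
      unfolding module.subspace_def[OF module_mult]
      using linear_eval_diff[of _ 0 0]
      by (auto simp: abs_symalg_add linear_eval_add free_contraction_mult
          simp flip: times_symalg.abs_eq zero_symalg.abs_eq)
  qed
  then show ?thesis by simp
qed

lemma ex_sym_derivation:
  assumes d: "linear_functional d"
  shows "\<exists>\<delta>. sym_derivation d \<delta>"
proof -
  let ?E = "linear_eval (contract_monomial d)"
  let ?\<delta> = "\<lambda>x. ?E (rep_symalg x)"
  have abs: "?\<delta> (abs_symalg a) = ?E a" for a
  proof -
    have "sym_eq (rep_symalg (abs_symalg a)) a"
      by (simp add: Quotient3_abs_rep[OF Quotient3_symalg] flip: symalg.abs_eq_iff)
    then show ?thesis
      using contraction_sym_ideal[OF d, of "rep_symalg (abs_symalg a) - a"]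
      by (simp add: sym_eq_def linear_eval_diff)
  qed
  have "sym_derivation d ?\<delta>"
    unfolding sym_derivation_def
  proof (intro conjI allI)
    fix x y :: "'a symalg" and a :: complex and v :: 'a
    obtain x' y' where xy: "x = abs_symalg x'" "y = abs_symalg y'"
      by (metis Quotient3_abs_rep[OF Quotient3_symalg])
    show "?\<delta> (x + y) = ?\<delta> x + ?\<delta> y"
      unfolding xy abs_symalg_add[symmetric] abs linear_eval_add ..
    show "?\<delta> (a *\<^sub>C x) = a *\<^sub>C ?\<delta> x"
      unfolding xy cscale_symalg_def sym_const.abs_eq times_symalg.abs_eq abs free_contraction_mult free_contraction_const
      by (simp add: sym_const.abs_eq)
    show "?\<delta> 1 = 0"
      using free_contraction_const[of d 1] unfolding one_symalg.abs_eq abs by (simp add: free_const_def)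
    show "?\<delta> (sym_gen v * x) = d v *\<^sub>C x + sym_gen v * ?\<delta> x"
      unfolding xy cscale_symalg_def sym_gen.abs_eq times_symalg.abs_eq abs free_contraction_mult free_contraction_gen
      by (simp add: mult.commute add.commute)
  qed
  then show ?thesis by blast
qed

lemma sym_derivation_zero: "sym_derivation d \<delta> \<Longrightarrow> \<delta> 0 = 0"
  unfolding sym_derivation_def by (metis add_cancel_left_left)

lemma sym_prod_Cons: "sym_prod (v # vs) = sym_gen v * sym_prod vs"
  by (simp add: sym_prod_def)

lemma sym_derivation_sym_prod:
  assumes \<delta>: "sym_derivation d \<delta>"
  shows "\<delta> (sym_prod vs) =
    (\<Sum>i<length vs. d (vs ! i) *\<^sub>C sym_prod (take i vs @ drop (Suc i) vs))"
proof (induction vs)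
  case Nil
  then show ?case using \<delta> by (simp add: sym_prod_def sym_derivation_def)
next
  case (Cons v vs)
  have "\<delta> (sym_prod (v # vs)) = d v *\<^sub>C sym_prod vs + sym_gen v * \<delta> (sym_prod vs)"
    using \<delta> by (simp add: sym_prod_Cons sym_derivation_def)
  also have "sym_gen v * \<delta> (sym_prod vs) =
      (\<Sum>i<length vs. d (vs ! i) *\<^sub>C sym_prod (take (Suc i) (v # vs) @ drop (Suc (Suc i)) (v # vs)))"
    by (simp add: Cons sum_distrib_left sym_prod_Cons cscale_mult_symalg)
  finally show ?case
    by (simp add: sum.lessThan_Suc_shift del: sum.lessThan_Suc)
qed

lemma symalg_on_induct [consumes 1, case_names zero add scale prod]:
  assumes "x \<in> symalg_on V" and "P 0" and "\<And>x y. P x \<Longrightarrow> P y \<Longrightarrow> P (x + y)"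
    and "\<And>a x. P x \<Longrightarrow> P (a *\<^sub>C x)" and "\<And>vs. set vs \<subseteq> V \<Longrightarrow> P (sym_prod vs)"
  shows "P x"
proof -
  interpret vector_space "cscale :: complex \<Rightarrow> 'a symalg \<Rightarrow> 'a symalg"
    by (rule vector_space_cscale)
  have "x \<in> Collect P"
    using assms(1) unfolding symalg_on_def
    by (rule span_induct) (use assms(2-5) in \<open>auto simp: subspace_def\<close>)
  then show ?thesis by simp
qed

lemma symalg_on_intros:
  shows symalg_on_zero: "0 \<in> symalg_on V"
    and symalg_on_add: "x \<in> symalg_on V \<Longrightarrow> y \<in> symalg_on V \<Longrightarrow> x + y \<in> symalg_on V"
    and symalg_on_scale: "x \<in> symalg_on V \<Longrightarrow> a *\<^sub>C x \<in> symalg_on V"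
    and symalg_on_prod: "set vs \<subseteq> V \<Longrightarrow> sym_prod vs \<in> symalg_on V"
proof -
  interpret vector_space "cscale :: complex \<Rightarrow> 'a symalg \<Rightarrow> 'a symalg"
    by (rule vector_space_cscale)
  show "0 \<in> symalg_on V" "x \<in> symalg_on V \<Longrightarrow> y \<in> symalg_on V \<Longrightarrow> x + y \<in> symalg_on V"
    "x \<in> symalg_on V \<Longrightarrow> a *\<^sub>C x \<in> symalg_on V" "set vs \<subseteq> V \<Longrightarrow> sym_prod vs \<in> symalg_on V"
    by (auto simp: symalg_on_def span_zero span_add span_scale intro!: span_base)
qed

lemma symalg_on_gen_mult: "x \<in> symalg_on V \<Longrightarrow> v \<in> V \<Longrightarrow> sym_gen v * x \<in> symalg_on V"
  by (induction rule: symalg_on_induct)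
    (auto simp: distrib_left cscale_mult_symalg simp flip: sym_prod_Cons intro!: symalg_on_intros)

lemma sym_derivation_closed:
  assumes \<delta>: "sym_derivation d \<delta>" and x: "x \<in> symalg_on V"
  shows "\<delta> x \<in> symalg_on V"
  using x
proof (induction rule: symalg_on_induct)
  case zero
  then show ?case using sym_derivation_zero[OF \<delta>] symalg_on_zero by metis
next
  case (prod vs)
  then show ?case
  proof (induction vs)
    case Nil
    then show ?case using \<delta> by (simp add: sym_prod_def sym_derivation_def symalg_on_zero)
  next
    case (Cons v vs)
    then show ?case
      using \<delta> by (auto simp: sym_prod_Cons sym_derivation_def intro!: symalg_on_intros symalg_on_gen_mult)
  qed
qed (use \<delta> in \<open>auto simp: sym_derivation_def intro!: symalg_on_intros\<close>)

lemma symalg_on_UNIV: "symalg_on (UNIV :: 'v::complex_vector set) = UNIV"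
proof -
  have "x \<in> symalg_on UNIV" for x :: "'v symalg"
  proof -
    obtain y where y: "x = abs_symalg y"
      by (metis Quotient3_abs_rep[OF Quotient3_symalg])
    have "sym_monomial m \<in> symalg_on UNIV" for m :: "'v multiset"
    proof -
      obtain vs where "m = mset vs" by (metis ex_mset)
      then have "sym_monomial m = sym_prod vs"
        by (simp add: sym_monomial_def sym_prod_def prod_mset_prod_list flip: mset_map)
      then show ?thesis by (simp add: symalg_on_prod)
    qed
    then show ?thesis
      unfolding y abs_symalg_eq_linear_eval
      by (induction y rule: free_induct)
        (auto simp: linear_eval_single linear_eval_add intro!: symalg_on_intros)
  qed
  then show ?thesis by auto
qed

text \<open>
  Agreement on \<open>V\<close> suffices. Coefficients such as \<open>J(\<phi> \<alpha>)\<close> are linear only on the forms with prescribed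
  regularity, and an extension to all forms involves a choice; by this lemma the choice does not matter.
\<close>

lemma sym_derivation_unique:
  assumes "sym_derivation d \<delta>" "sym_derivation d' \<delta>'" "\<And>v. v \<in> V \<Longrightarrow> d v = d' v"
    and "x \<in> symalg_on V"
  shows "\<delta> x = \<delta>' x"
  using assms(4)
proof (induction rule: symalg_on_induct)
  case zero
  then show ?case using assms sym_derivation_zero by metis
next
  case (prod vs)
  then show ?case
    by (induction vs) (use assms in \<open>auto simp: sym_prod_Cons sym_derivation_def sym_prod_def\<close>)
qed (use assms in \<open>auto simp: sym_derivation_def\<close>)

lemma sym_derivation_plus:
  assumes "sym_derivation d \<delta>" "sym_derivation d' \<delta>'"
  shows "sym_derivation (\<lambda>v. d v + d' v) (\<lambda>x. \<delta> x + \<delta>' x)"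
  using assms by (auto simp: sym_derivation_def algebra_simps cscale_add_left cscale_add_right)

text \<open>
  The contraction of a generator is a scalar, which the other derivation kills. So on a product
  \<open>v \<cdot> y\<close> both orders give \<open>d' v \<cdot> \<delta> y + d v \<cdot> \<delta>' y\<close> plus \<open>v\<close> times the two compositions at \<open>y\<close>.
\<close>

lemma sym_derivations_commute:
  fixes x :: "'v::complex_vector symalg"
  assumes \<delta>: "sym_derivation d \<delta>" and \<delta>': "sym_derivation d' \<delta>'"
  shows "\<delta> (\<delta>' x) = \<delta>' (\<delta> x)"
proof -
  have "x \<in> symalg_on UNIV" by (simp add: symalg_on_UNIV)
  then show ?thesis
  proof (induction rule: symalg_on_induct)
    case zero
    show ?case using assms sym_derivation_zero by metis
  next
    case (prod vs)
    show ?case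
    proof (induction vs)
      case Nil
      have "\<delta> 0 = 0" "\<delta>' 0 = 0" using assms sym_derivation_zero by auto
      then show ?case using assms by (simp add: sym_prod_def sym_derivation_def)
    next
      case (Cons v vs)
      then show ?case using assms by (simp add: sym_prod_Cons sym_derivation_def add.left_commute)
    qed
  qed (use assms in \<open>auto simp: sym_derivation_def\<close>)
qed

text \<open>
  The Heisenberg relation: the derivations commute with each other, the multiplications as well, and the
  mixed terms leave only the contractions of \<open>b\<close> and \<open>b'\<close>.
\<close>

lemma commutator_derivation_plus_multiplication:
  assumes \<delta>: "sym_derivation d \<delta>" and \<delta>': "sym_derivation d' \<delta>'"
  shows "(\<delta> (\<delta>' x + sym_gen b' * x) + sym_gen b * (\<delta>' x + sym_gen b' * x)) -
     (\<delta>' (\<delta> x + sym_gen b * x) + sym_gen b' * (\<delta> x + sym_gen b * x)) = (d b' - d' b) *\<^sub>C x"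
proof -
  have *: "(d b' - d' b) *\<^sub>C x = d b' *\<^sub>C x - d' b *\<^sub>C x"
    using cscale_add_left[of "d b' - d' b" "d' b" x] by (simp add: algebra_simps)
  show ?thesis
    using sym_derivations_commute[OF \<delta> \<delta>', of x] \<delta> \<delta>'
    by (simp add: sym_derivation_def algebra_simps *)
qed

text \<open>
  A derivation is constructed on the whole symmetric algebra, whereas a coefficient is linear only on a
  subspace; extending it along a basis avoids comparing \<open>symalg_on V\<close> with the symmetric algebra of \<open>V\<close>
  itself.
\<close>

lemma linear_functional_extend:
  fixes c :: "'v::complex_vector \<Rightarrow> complex"
  assumes V: "module.subspace cscale V"
    and add: "\<And>v w. v \<in> V \<Longrightarrow> w \<in> V \<Longrightarrow> c (v + w) = c v + c w"
    and scale: "\<And>a v. v \<in> V \<Longrightarrow> c (a *\<^sub>C v) = a * c v"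
  shows "\<exists>d. linear_functional d \<and> (\<forall>v\<in>V. d v = c v)"
proof -
  interpret v: vector_space "cscale :: complex \<Rightarrow> 'v \<Rightarrow> 'v" by (rule vector_space_cscale)
  interpret vector_space_pair "cscale :: complex \<Rightarrow> 'v \<Rightarrow> 'v" "(*) :: complex \<Rightarrow> complex \<Rightarrow> complex"
    by unfold_locales (auto simp: algebra_simps)
  obtain B where B: "B \<subseteq> V" "v.independent B" "V \<subseteq> v.span B"
    using v.basis_exists[of V] by metis
  obtain d where d: "Vector_Spaces.linear cscale (*) d" "\<forall>x\<in>B. d x = c x"
    using linear_independent_extend[OF B(2)] by metis
  have lin: "linear_functional d"
  proof -
    interpret d: Vector_Spaces.linear "cscale :: complex \<Rightarrow> 'v \<Rightarrow> 'v" "(*)" d by (rule d(1))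
    show ?thesis by (simp add: linear_functional_def d.add d.scale)
  qed
  have c0: "c 0 = 0"
    using add[of 0 0] V v.subspace_0 by fastforce
  have "v.span B \<subseteq> {v \<in> V. d v = c v}"
  proof (rule v.span_minimal)
    show "B \<subseteq> {v \<in> V. d v = c v}" using B d by auto
    have "d 0 = 0" using lin unfolding linear_functional_def by (metis add_cancel_left_left)
    then show "v.subspace {v \<in> V. d v = c v}"
      using V add scale c0 lin by (auto simp: v.subspace_def linear_functional_def)
  qed
  then show ?thesis using lin B by blast
qed

lemma linear_on_symalg_eqI:
  assumes "linear_on_symalg (symalg_on V) T" "linear_on_symalg (symalg_on V) T'"
    and prod: "\<And>vs. set vs \<subseteq> V \<Longrightarrow> T (sym_prod vs) = T' (sym_prod vs)"
    and "x \<in> symalg_on V"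
  shows "T x = T' x"
proof -
  have add: "T (x + y) = T x + T y" "T' (x + y) = T' x + T' y"
    if "x \<in> symalg_on V" "y \<in> symalg_on V" for x y
    using assms(1,2) that by (simp_all add: linear_on_symalg_def)
  have scale: "T (a *\<^sub>C x) = a *\<^sub>C T x" "T' (a *\<^sub>C x) = a *\<^sub>C T' x"
    if "x \<in> symalg_on V" for a x
    using assms(1,2) that by (simp_all add: linear_on_symalg_def)
  have "x \<in> symalg_on V \<and> T x = T' x"
    using assms(4)
  proof (induction rule: symalg_on_induct)
    case zero
    show ?case using add[of 0 0] symalg_on_zero[of V] by simp
  qed (simp_all add: add scale prod symalg_on_add symalg_on_scale symalg_on_prod)
  then show ?thesis by simp
qed

text \<open>
  The definite description in \<open>symalg_operator\<close> denotes a derivation plus a multiplication: these satisfy the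
  required formula on products, and products span.
\<close>

lemma symalg_operator_eq:
  assumes \<beta>: "\<beta> \<in> V"
    and \<delta>: "sym_derivation d \<delta>" and d: "\<And>v. v \<in> V \<Longrightarrow> d v = c v"
  shows "symalg_operator V c \<beta> =
    (\<lambda>x. if x \<in> symalg_on V then \<delta> x + sym_gen \<beta> * x else 0)"
proof -
  define T0 where "T0 = (\<lambda>x. if x \<in> symalg_on V then \<delta> x + sym_gen \<beta> * x else 0)"
  have on: "T0 x = \<delta> x + sym_gen \<beta> * x" if "x \<in> symalg_on V" for x
    using that by (simp add: T0_def)
  have off: "T0 x = 0" if "x \<notin> symalg_on V" for x
    using that by (simp add: T0_def)
  have lin: "linear_on_symalg (symalg_on V) T0"
    using \<delta> by (simp add: linear_on_symalg_def on symalg_on_add symalg_on_scale sym_derivation_def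
        cscale_add_right cscale_mult_symalg distrib_left)
  have closed: "T0 ` symalg_on V \<subseteq> symalg_on V"
    using \<beta> by (auto simp: on intro!: symalg_on_add symalg_on_gen_mult sym_derivation_closed[OF \<delta>])
  have prod: "T0 (sym_prod vs) =
      (\<Sum>i<length vs. c (vs ! i) *\<^sub>C sym_prod (take i vs @ drop (Suc i) vs))
      + sym_gen \<beta> * sym_prod vs" if "set vs \<subseteq> V" for vs
  proof -
    have "d (vs ! i) = c (vs ! i)" if "i < length vs" for i
      using d \<open>set vs \<subseteq> V\<close> that by (meson nth_mem subsetD)
    then show ?thesis
      using that by (simp add: on symalg_on_prod sym_derivation_sym_prod[OF \<delta>])
  qed
  have "symalg_operator V c \<beta> = T0"
    unfolding symalg_operator_def
  proof (rule the_equality, intro conjI allI impI)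
    fix T
    assume T: "linear_on_symalg (symalg_on V) T \<and> T ` symalg_on V \<subseteq> symalg_on V \<and>
      (\<forall>x. x \<notin> symalg_on V \<longrightarrow> T x = 0) \<and>
      (\<forall>vs. set vs \<subseteq> V \<longrightarrow> T (sym_prod vs) =
         (\<Sum>i<length vs. c (vs ! i) *\<^sub>C sym_prod (take i vs @ drop (Suc i) vs))
         + sym_gen \<beta> * sym_prod vs)"
    have "T x = T0 x" if "x \<in> symalg_on V" for x
      by (rule linear_on_symalg_eqI[OF _ lin _ that]) (use T prod in auto)
    then show "T = T0" using T off by (metis ext)
  qed (fact lin closed off prod)+
  then show ?thesis by (simp add: T0_def)
qed

lemma sym_gen_zero: "sym_gen 0 = (0 :: 'v::complex_vector symalg)"
proof -
  have "sym_eq (free_gen (0 :: 'v)) 0"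
  proof -
    have "free_gen (0 *\<^sub>C (0::'v)) - free_const 0 * free_gen 0 \<in> sym_ideal"
      unfolding sym_ideal_def by (rule module.span_base[OF module_mult]) (auto simp: sym_relations_def)
    then show ?thesis by (simp add: sym_eq_def free_const_def cscale_zero_left)
  qed
  then show ?thesis by (simp add: sym_gen.abs_eq zero_symalg.abs_eq symalg.abs_eq_iff)
qed

section \<open>Regular germs\<close>

text \<open>
  Regularity up to a removable singularity. It is equivalent to being meromorphic without a pole, but in this
  form it is visibly stable under sums, products, derivatives and holomorphic substitutions.
\<close>

definition regular_germ :: "(complex \<Rightarrow> complex) \<Rightarrow> complex \<Rightarrow> bool" where
  "regular_germ f z \<longleftrightarrow> (\<exists>g. g analytic_on {z} \<and> eventually (\<lambda>u. f u = g u) (at z))"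

lemma regular_germ_analytic: "f analytic_on {z} \<Longrightarrow> regular_germ f z"
  unfolding regular_germ_def by (intro exI[of _ f]) auto

lemma regular_germ_cong:
  assumes "eventually (\<lambda>u. f u = g u) (at z)"
  shows "regular_germ f z \<longleftrightarrow> regular_germ g z"
proof -
  have "regular_germ g z" if "regular_germ f z" "eventually (\<lambda>u. f u = g u) (at z)" for f g
  proof -
    obtain h where h: "h analytic_on {z}" "eventually (\<lambda>u. f u = h u) (at z)"
      using \<open>regular_germ f z\<close> unfolding regular_germ_def by blast
    from h(2) that(2) have "eventually (\<lambda>u. g u = h u) (at z)" by eventually_elim simp
    then show ?thesis using h(1) unfolding regular_germ_def by blast
  qed
  moreover have "eventually (\<lambda>u. g u = f u) (at z)" using assms by (simp add: eq_commute)
  ultimately show ?thesis using assms by metis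
qed

lemma regular_germ_add:
  assumes "regular_germ f z" "regular_germ g z"
  shows "regular_germ (\<lambda>u. f u + g u) z"
proof -
  obtain f' g' where "f' analytic_on {z}" "eventually (\<lambda>u. f u = f' u) (at z)"
    "g' analytic_on {z}" "eventually (\<lambda>u. g u = g' u) (at z)"
    using assms unfolding regular_germ_def by blast
  then show ?thesis unfolding regular_germ_def
    by (intro exI[of _ "\<lambda>u. f' u + g' u"]) (auto intro!: analytic_intros elim: eventually_elim2)
qed

lemma regular_germ_mult:
  assumes "regular_germ f z" "regular_germ g z"
  shows "regular_germ (\<lambda>u. f u * g u) z"
proof -
  obtain f' g' where "f' analytic_on {z}" "eventually (\<lambda>u. f u = f' u) (at z)"
    "g' analytic_on {z}" "eventually (\<lambda>u. g u = g' u) (at z)"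
    using assms unfolding regular_germ_def by blast
  then show ?thesis unfolding regular_germ_def
    by (intro exI[of _ "\<lambda>u. f' u * g' u"]) (auto intro!: analytic_intros elim: eventually_elim2)
qed

lemma regular_germ_const: "regular_germ (\<lambda>u. c) z"
  by (intro regular_germ_analytic analytic_intros)

lemma regular_germ_deriv:
  assumes "regular_germ f z"
  shows "regular_germ (deriv f) z"
proof -
  obtain g where g: "g analytic_on {z}" "eventually (\<lambda>u. f u = g u) (at z)"
    using assms unfolding regular_germ_def by blast
  have "eventually (\<lambda>u. eventually (\<lambda>w. f w = g w) (nhds u)) (at z)"
  proof -
    have "eventually (\<lambda>u. eventually (\<lambda>w. w \<noteq> z \<longrightarrow> f w = g w) (nhds u)) (nhds z)"
      using g(2) by (simp add: eventually_eventually eventually_at_filter)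
    then show ?thesis
      unfolding eventually_at_filter
    proof eventually_elim
      case (elim u)
      show ?case
      proof (intro impI)
        assume "u \<noteq> z"
        then have "eventually (\<lambda>w. w \<noteq> z) (nhds u)" by (rule t1_space_nhds)
        with elim show "eventually (\<lambda>w. f w = g w) (nhds u)" by eventually_elim simp
      qed
    qed
  qed
  then have "eventually (\<lambda>u. deriv f u = deriv g u) (at z)"
    by eventually_elim (rule deriv_cong_ev, auto)
  then show ?thesis using g(1) analytic_deriv unfolding regular_germ_def by blast
qed

lemma remove_sings_regular_germ:
  assumes "f meromorphic_on {z}" "\<not> is_pole f z"
  shows "remove_sings f analytic_on {z}" "eventually (\<lambda>u. f u = remove_sings f u) (at z)"
proof -
  have iso: "isolated_singularity_at f z" and "not_essential f z"
    using assms by (auto simp: meromorphic_at_iff)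
  then obtain c where "f \<midarrow>z\<rightarrow> c" using assms(2) unfolding not_essential_def by blast
  then show "remove_sings f analytic_on {z}" by (rule remove_sings_analytic_at[OF iso])
  show "eventually (\<lambda>u. f u = remove_sings f u) (at z)"
    using eventually_remove_sings_eq_at[OF iso] by eventually_elim simp
qed

lemma regular_germ_iff_meromorphic:
  "regular_germ f z \<longleftrightarrow> f meromorphic_on {z} \<and> \<not> is_pole f z"
proof safe
  assume "regular_germ f z"
  then obtain g where g: "g analytic_on {z}" "eventually (\<lambda>u. f u = g u) (at z)"
    unfolding regular_germ_def by blast
  show "f meromorphic_on {z}"
    using g analytic_on_imp_meromorphic_on meromorphic_on_cong[of "{z}" f g "{z}"] by auto
  assume "is_pole f z"
  then have "is_pole g z" using g(2) is_pole_cong by blast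
  then show False using g(1) analytic_at_imp_no_pole by blast
next
  assume "f meromorphic_on {z}" "\<not> is_pole f z"
  from remove_sings_regular_germ[OF this] show "regular_germ f z" unfolding regular_germ_def by blast
qed

lemma residue_regular_germ:
  assumes "regular_germ f z"
  shows "residue f z = 0"
proof -
  obtain g where g: "g analytic_on {z}" "eventually (\<lambda>u. f u = g u) (at z)"
    using assms unfolding regular_germ_def by blast
  obtain S where "open S" "z \<in> S" "g holomorphic_on S"
    using g(1) by (auto simp: analytic_at)
  then have "residue g z = 0" by (rule residue_holo)
  then show ?thesis using residue_cong[OF g(2) refl] by simp
qed

lemma eventually_compose_at:
  fixes h :: "complex \<Rightarrow> complex"
  assumes "h analytic_on {z}" "eventually (\<lambda>w. h w \<noteq> h z) (at z)" "eventually P (at (h z))"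
  shows "eventually (\<lambda>w. P (h w)) (at z)"
proof -
  have "(h \<longlongrightarrow> h z) (at z)"
    using analytic_at_imp_isCont[OF assms(1)] by (simp add: isCont_def)
  then have "filterlim h (at (h z)) (at z)"
    using assms(2) by (simp add: filterlim_at)
  then show ?thesis using assms(3) by (simp add: filterlim_iff)
qed

lemma regular_germ_compose:
  assumes "h analytic_on {z}" "eventually (\<lambda>w. h w \<noteq> h z) (at z)" "regular_germ f (h z)"
  shows "regular_germ (\<lambda>w. f (h w)) z"
proof -
  obtain g where g: "g analytic_on {h z}" "eventually (\<lambda>u. f u = g u) (at (h z))"
    using assms unfolding regular_germ_def by blast
  have "(\<lambda>w. g (h w)) analytic_on {z}"
    using analytic_on_compose[of h "{z}" g] assms(1) g(1) by (simp add: o_def)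
  then show ?thesis
    using eventually_compose_at[OF assms(1,2) g(2)] unfolding regular_germ_def by blast
qed

lemma meromorphic_eventually_analytic:
  assumes "f meromorphic_on {z}"
  shows "eventually (\<lambda>u. f analytic_on {u}) (at z)"
proof -
  have "isolated_singularity_at f z" using assms by (simp add: meromorphic_at_iff)
  then obtain r where "r > 0" "f analytic_on ball z r - {z}"
    by (auto simp: isolated_singularity_at_def)
  then show ?thesis
    unfolding eventually_at
    by (intro exI[of _ r]) (auto intro: analytic_on_subset simp: dist_commute)
qed

lemma residue_deriv:
  assumes "f meromorphic_on {0}"
  shows "residue (deriv f) 0 = 0"
proof -
  obtain F where F: "f has_laurent_expansion F"
    using assms by (auto simp: meromorphic_on_def)
  show ?thesis
    using has_laurent_expansion_residue_0[OF has_laurent_expansion_deriv[OF F]] by simp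
qed

section \<open>Finite sets of exceptional points\<close>

lemma inj_local_param: "inj (local_param p)"
  by (cases p) (auto simp: inj_on_def split: if_splits)

text \<open>
  Values at isolated points are irrelevant, and the projective line is compact. Therefore equality of
  coefficient functions near every point, except possibly at the point itself, is the same as equality off
  a finite set, which can be expressed by the cofinite filter without mentioning charts.
\<close>

lemma cofinite_imp_local:
  assumes "eventually P cofinite"
  shows "eventually (\<lambda>u. P (local_param p u)) (at 0)"
proof -
  have "finite (local_param p -` {x. \<not> P x})"
    using assms by (intro finite_vimageI inj_local_param) (simp add: eventually_cofinite)
  then have "\<not> 0 islimpt {u. \<not> P (local_param p u)}"
    by (simp add: islimpt_finite vimage_def)
  then show ?thesis by (simp add: islimpt_iff_eventually)
qed

lemma eventually_at_Some_iff:
  "eventually (\<lambda>u. P (local_param (Some a) u)) (at 0) \<longleftrightarrow> eventually (\<lambda>z. P (Some z)) (at a)"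
  by (simp add: at_to_0'[of a] eventually_filtermap add_ac)

text \<open>
  Near infinity there are no exceptions outside a large disc, and inside that disc the exceptions do
  not accumulate.
\<close>

lemma cofinite_if_local:
  assumes "\<And>p. eventually (\<lambda>u. P (local_param p u)) (at 0)"
  shows "eventually P cofinite"
proof -
  obtain r where r: "r > 0" "\<And>u. u \<noteq> 0 \<Longrightarrow> norm u < r \<Longrightarrow> P (Some (1 / u))"
    using assms[of None] by (force simp: eventually_at)
  let ?E = "{z. \<not> P (Some z)}"
  have "?E \<subseteq> cball 0 (1 / r)"
  proof
    fix z assume z: "z \<in> ?E"
    show "z \<in> cball 0 (1 / r)"
    proof (rule ccontr)
      assume "z \<notin> cball 0 (1 / r)"
      then have z': "norm z > 1 / r" by simp
      then have "0 < norm z" using r(1) by (smt (verit) divide_pos_pos)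
      then have "norm (1 / z) < r" "z \<noteq> 0"
        using r(1) z' by (auto simp: norm_divide field_simps)
      then show False using r(2)[of "1 / z"] z by simp
    qed
  qed
  moreover have "\<not> z islimpt ?E" for z
    using assms[of "Some z"] by (simp add: islimpt_iff_eventually eventually_at_Some_iff del: local_param.simps)
  ultimately have "finite ?E"
    using finite_not_islimpt_in_compact[of "cball 0 (1/r)" ?E] by (simp add: Int_absorb1 Int_absorb2)
  then have "finite (insert None (Some ` ?E))" by simp
  moreover have "{p. \<not> P p} \<subseteq> insert None (Some ` ?E)"
    by (auto simp: image_iff) (metis not_Some_eq)
  ultimately show ?thesis unfolding eventually_cofinite by (rule finite_subset[rotated])
qed

lemma cofinite_Some_iff:
  "eventually (\<lambda>z. P (Some z)) cofinite \<longleftrightarrow> eventually P cofinite"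
proof
  assume "eventually (\<lambda>z. P (Some z)) cofinite"
  then have "finite (insert None (Some ` {z. \<not> P (Some z)}))" by (simp add: eventually_cofinite)
  moreover have "{p. \<not> P p} \<subseteq> insert None (Some ` {z. \<not> P (Some z)})"
    by (auto simp: image_iff) (metis not_Some_eq)
  ultimately show "eventually P cofinite" unfolding eventually_cofinite by (rule finite_subset[rotated])
next
  assume "eventually P cofinite"
  then show "eventually (\<lambda>z. P (Some z)) cofinite"
    using finite_vimageI[of "{p. \<not> P p}" Some] by (simp add: eventually_cofinite vimage_def)
qed

lemma form_at_cong:
  assumes "eventually (\<lambda>z. f z = g z) cofinite"
  shows "eventually (\<lambda>u. form_at f p u = form_at g p u) (at 0)"
proof -
  have "eventually (\<lambda>x. f (coord None x) = g (coord None x)) cofinite"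
    using assms by (simp flip: cofinite_Some_iff)
  from cofinite_imp_local[OF this, of p] have "eventually (\<lambda>u. f (coord None (local_param p u)) =
    g (coord None (local_param p u))) (at 0)" .
  moreover have "eventually (\<lambda>u::complex. u \<noteq> 0) (at 0)"
    by (simp add: eventually_at_filter)
  ultimately show ?thesis
    by eventually_elim (cases p; auto)
qed

section \<open>Functions and forms of prescribed regularity\<close>

definition reg_funs :: "cp1 set \<Rightarrow> (cp1 \<Rightarrow> complex) set" where
  "reg_funs A = {\<phi>. mero_fun \<phi> \<and> fun_regular_on \<phi> A}"

definition reg_forms :: "cp1 set \<Rightarrow> (complex \<Rightarrow> complex) set" where
  "reg_forms A = {f. mero_form f \<and> form_regular_on f A}"

lemma reg_funs_iff:
  "\<phi> \<in> reg_funs A \<longleftrightarrow> mero_fun \<phi> \<and> (\<forall>p\<in>A. regular_germ (\<lambda>u. \<phi> (local_param p u)) 0)"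
  by (auto simp: reg_funs_def fun_regular_on_def mero_fun_def regular_germ_iff_meromorphic)

lemma reg_forms_iff:
  "f \<in> reg_forms A \<longleftrightarrow> mero_form f \<and> (\<forall>p\<in>A. regular_germ (form_at f p) 0)"
  by (auto simp: reg_forms_def form_regular_on_def mero_form_def regular_germ_iff_meromorphic)

lemma reg_funs_mono: "\<phi> \<in> reg_funs A \<Longrightarrow> B \<subseteq> A \<Longrightarrow> \<phi> \<in> reg_funs B"
  by (auto simp: reg_funs_iff)

lemma reg_forms_mono: "f \<in> reg_forms A \<Longrightarrow> B \<subseteq> A \<Longrightarrow> f \<in> reg_forms B"
  by (auto simp: reg_forms_iff)

lemma reg_funs_const: "(\<lambda>p. c) \<in> reg_funs A"
  by (auto simp: reg_funs_iff mero_fun_def regular_germ_const)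

lemma reg_funs_add: "\<phi> \<in> reg_funs A \<Longrightarrow> \<psi> \<in> reg_funs A \<Longrightarrow> (\<lambda>p. \<phi> p + \<psi> p) \<in> reg_funs A"
  by (auto simp: reg_funs_iff mero_fun_def regular_germ_add intro!: meromorphic_intros)

lemma reg_funs_mult: "\<phi> \<in> reg_funs A \<Longrightarrow> \<psi> \<in> reg_funs A \<Longrightarrow> (\<lambda>p. \<phi> p * \<psi> p) \<in> reg_funs A"
  by (auto simp: reg_funs_iff mero_fun_def regular_germ_mult intro!: meromorphic_intros)

lemma reg_funs_diff: "\<phi> \<in> reg_funs A \<Longrightarrow> \<psi> \<in> reg_funs A \<Longrightarrow> (\<lambda>p. \<phi> p - \<psi> p) \<in> reg_funs A"
  using reg_funs_add[OF _ reg_funs_mult[OF reg_funs_const[of "-1"]]] by fastforce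

lemma reg_forms_add: "f \<in> reg_forms A \<Longrightarrow> g \<in> reg_forms A \<Longrightarrow> (\<lambda>z. f z + g z) \<in> reg_forms A"
  by (auto simp: reg_forms_iff mero_form_def form_at_add regular_germ_add intro!: meromorphic_intros)

lemma reg_forms_cmult: "f \<in> reg_forms A \<Longrightarrow> (\<lambda>z. c * f z) \<in> reg_forms A"
  by (auto simp: reg_forms_iff mero_form_def form_at_cmult regular_germ_const
      intro!: meromorphic_intros regular_germ_mult)

lemma reg_forms_germ_cong:
  assumes "\<And>p. eventually (\<lambda>u. form_at f p u = g p u) (at 0)"
  shows "f \<in> reg_forms A \<longleftrightarrow>
    (\<forall>p. g p meromorphic_on {0}) \<and> (\<forall>p\<in>A. regular_germ (g p) 0)"
proof -
  have "form_at f p meromorphic_on {0} \<longleftrightarrow> g p meromorphic_on {0}" for p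
    using assms by (intro meromorphic_on_cong) auto
  then show ?thesis
    using regular_germ_cong[OF assms] by (simp add: reg_forms_iff mero_form_def)
qed

lemma reg_forms_cong:
  assumes "eventually (\<lambda>z. f z = g z) cofinite" "f \<in> reg_forms A"
  shows "g \<in> reg_forms A"
  using assms(2) reg_forms_germ_cong[OF form_at_cong[OF assms(1)]]
  by (simp add: reg_forms_iff mero_form_def)

lemma form_at_fun_times_form:
  "u \<noteq> 0 \<Longrightarrow> form_at (fun_times_form \<phi> f) p u = \<phi> (local_param p u) * form_at f p u"
  by (cases p) (auto simp: fun_times_form_def)

lemma form_at_fun_times_form_ev:
  "eventually (\<lambda>u. form_at (fun_times_form \<phi> f) p u = \<phi> (local_param p u) * form_at f p u) (at 0)"
  using form_at_fun_times_form by (auto simp: eventually_at_filter)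

lemma reg_forms_fun_times:
  assumes "\<phi> \<in> reg_funs A" "f \<in> reg_forms A"
  shows "fun_times_form \<phi> f \<in> reg_forms A"
  unfolding reg_forms_germ_cong[OF form_at_fun_times_form_ev]
  using assms unfolding reg_funs_iff reg_forms_iff mero_fun_def mero_form_def
  by (auto intro!: regular_germ_mult meromorphic_on_mult)

lemma mero_fun_analytic:
  assumes "mero_fun \<phi>"
  shows "eventually (\<lambda>z. (\<lambda>w. \<phi> (Some w)) analytic_on {z}) cofinite"
proof -
  let ?P = "\<lambda>p. case p of None \<Rightarrow> True | Some z \<Rightarrow> (\<lambda>w. \<phi> (Some w)) analytic_on {z}"
  have "eventually ?P cofinite"
  proof (rule cofinite_if_local)
    fix p
    have ev: "eventually (\<lambda>u. (\<lambda>u. \<phi> (local_param p u)) analytic_on {u}) (at 0)"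
      using assms by (intro meromorphic_eventually_analytic) (auto simp: mero_fun_def)
    have "eventually (\<lambda>u::complex. u \<noteq> 0) (at 0)"
      by (simp add: eventually_at_filter)
    with ev show "eventually (\<lambda>u. ?P (local_param p u)) (at 0)"
    proof eventually_elim
      case (elim u)
      show ?case
      proof (cases p)
        case None
        have "((\<lambda>u. \<phi> (local_param p u)) \<circ> (\<lambda>z. 1 / z)) analytic_on {1 / u}"
          using elim by (intro analytic_on_compose analytic_intros) auto
        moreover have "eventually (\<lambda>z. ((\<lambda>u. \<phi> (local_param p u)) \<circ> (\<lambda>z. 1 / z)) z = \<phi> (Some z)) (nhds (1 / u))"
          using elim None by (intro eventually_mono[OF t1_space_nhds[of "1 / u" 0]]) auto
        ultimately have "(\<lambda>w. \<phi> (Some w)) analytic_on {1 / u}"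
          by (simp only: analytic_at_cong[OF _ refl])
        then show ?thesis using None elim by simp
      next
        case (Some a)
        have "((\<lambda>u. \<phi> (local_param p u)) \<circ> (\<lambda>z. z - a)) analytic_on {a + u}"
          using elim by (intro analytic_on_compose analytic_intros) auto
        then show ?thesis using Some by (simp add: o_def)
      qed
    qed
  qed
  then show ?thesis by (simp flip: cofinite_Some_iff)
qed

lemma dcoeff_field_derivative:
  assumes "mero_fun \<phi>"
  shows "eventually (\<lambda>z. ((\<lambda>w. \<phi> (Some w)) has_field_derivative dcoeff \<phi> z) (at z)) cofinite"
  using mero_fun_analytic[OF assms]
  by eventually_elim
    (auto simp: dcoeff_def intro!: DERIV_deriv_iff_field_differentiable[THEN iffD2]
      analytic_on_imp_differentiable_at)

lemma dcoeff_add: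
  assumes "mero_fun \<phi>" "mero_fun \<psi>"
  shows "eventually (\<lambda>z. dcoeff (\<lambda>p. \<phi> p + \<psi> p) z = dcoeff \<phi> z + dcoeff \<psi> z) cofinite"
  using dcoeff_field_derivative[OF assms(1)] dcoeff_field_derivative[OF assms(2)]
  by eventually_elim (auto simp: dcoeff_def[of "\<lambda>p. \<phi> p + \<psi> p"] intro!: DERIV_imp_deriv DERIV_add)

lemma dcoeff_mult:
  assumes "mero_fun \<phi>" "mero_fun \<psi>"
  shows "eventually (\<lambda>z. dcoeff (\<lambda>p. \<phi> p * \<psi> p) z =
    \<phi> (Some z) * dcoeff \<psi> z + \<psi> (Some z) * dcoeff \<phi> z) cofinite"
  using dcoeff_field_derivative[OF assms(1)] dcoeff_field_derivative[OF assms(2)]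
  by eventually_elim (auto simp: dcoeff_def[of "\<lambda>p. \<phi> p * \<psi> p"] mult.commute
      intro!: DERIV_imp_deriv derivative_eq_intros)

text \<open>
  The differential does not depend on the chart: at infinity the chain rule for \<open>z = 1 / u\<close> produces the factor
  \<open>- 1 / u^2\<close> built into \<open>form_at\<close>.
\<close>

lemma form_at_dcoeff:
  assumes "mero_fun \<phi>"
  shows "eventually (\<lambda>u. form_at (dcoeff \<phi>) p u = deriv (\<lambda>u. \<phi> (local_param p u)) u) (at 0)"
proof -
  have "eventually (\<lambda>x. case x of None \<Rightarrow> True | Some z \<Rightarrow>
      ((\<lambda>w. \<phi> (Some w)) has_field_derivative dcoeff \<phi> z) (at z)) cofinite"
    using dcoeff_field_derivative[OF assms] by (simp flip: cofinite_Some_iff)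
  from cofinite_imp_local[OF this, of p]
  have ev: "eventually (\<lambda>u. case local_param p u of None \<Rightarrow> True | Some z \<Rightarrow>
      ((\<lambda>w. \<phi> (Some w)) has_field_derivative dcoeff \<phi> z) (at z)) (at 0)" .
  have "eventually (\<lambda>u::complex. u \<noteq> 0) (at 0)"
    by (simp add: eventually_at_filter)
  with ev show ?thesis
  proof eventually_elim
    case (elim u)
    show ?case
    proof (cases p)
      case None
      have "((\<lambda>u. \<phi> (Some (1 / u))) has_field_derivative dcoeff \<phi> (1 / u) * (- 1 / u ^ 2)) (at u)"
      proof (rule DERIV_chain2[where f = "\<lambda>w. \<phi> (Some w)"])
        show "((\<lambda>w. \<phi> (Some w)) has_field_derivative dcoeff \<phi> (1 / u)) (at (1 / u))"
          using elim None by simp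
        show "((/) 1 has_field_derivative - 1 / u\<^sup>2) (at u)"
          using elim by (auto intro!: derivative_eq_intros simp: power2_eq_square)
      qed
      then have "deriv (\<lambda>u. \<phi> (Some (1 / u))) u = - dcoeff \<phi> (1 / u) / u ^ 2"
        by (simp add: DERIV_imp_deriv)
      moreover have "deriv (\<lambda>u. \<phi> (local_param p u)) u = deriv (\<lambda>u. \<phi> (Some (1 / u))) u"
        using elim None by (intro deriv_cong_ev eventually_mono[OF t1_space_nhds[of u 0]]) auto
      ultimately show ?thesis using None by simp
    next
      case (Some a)
      have "((\<lambda>u. \<phi> (Some (a + u))) has_field_derivative dcoeff \<phi> (a + u) * 1) (at u)"
        by (rule DERIV_chain2[where f = "\<lambda>w. \<phi> (Some w)"])
          (use elim Some in \<open>auto intro!: derivative_eq_intros\<close>)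
      then show ?thesis using Some by (simp add: DERIV_imp_deriv)
    qed
  qed
qed

lemma reg_forms_dcoeff:
  assumes "\<phi> \<in> reg_funs A"
  shows "dcoeff \<phi> \<in> reg_forms A"
proof -
  have \<phi>: "mero_fun \<phi>" using assms by (simp add: reg_funs_iff)
  show ?thesis
    unfolding reg_forms_germ_cong[OF form_at_dcoeff[OF \<phi>]]
    using assms unfolding reg_funs_iff mero_fun_def
    by (auto intro!: regular_germ_deriv meromorphic_on_deriv)
qed

lemma residue_free_dcoeff:
  assumes "mero_fun \<phi>"
  shows "residue_free (dcoeff \<phi>)"
proof -
  have "mero_form (dcoeff \<phi>)"
    using reg_forms_dcoeff[of \<phi> "{}"] assms by (auto simp: reg_funs_iff reg_forms_iff)
  moreover have "Res p (dcoeff \<phi>) = 0" for p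
    using assms residue_deriv residue_cong[OF form_at_dcoeff[OF assms] refl]
    by (auto simp: Res_def mero_fun_def)
  ultimately show ?thesis by (simp add: residue_free_def)
qed

section \<open>Splitting off principal parts, and Liouville's theorem\<close>

text \<open>
  Subtracting \<open>h 0 / u^(n + 1)\<close> lowers the pole order, because \<open>(h u - h 0) / u\<close> has a removable
  singularity.
\<close>

lemma ex_principal_part_order:
  assumes "regular_germ (\<lambda>u. u ^ n * f u) 0"
  shows "\<exists>Q. regular_germ (\<lambda>u. f u - poly Q (1 / u)) 0"
  using assms
proof (induction n arbitrary: f)
  case 0
  then show ?case by (intro exI[of _ 0]) simp
next
  case (Suc n)
  then obtain h where h: "h analytic_on {0}" "eventually (\<lambda>u. u ^ Suc n * f u = h u) (at 0)"
    unfolding regular_germ_def by blast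
  let ?f = "\<lambda>u. f u - h 0 / u ^ Suc n"
  have nz: "eventually (\<lambda>u::complex. u \<noteq> 0) (at 0)" by (simp add: eventually_at_filter)
  have "((\<lambda>u. (h u - h 0) / u) \<longlongrightarrow> deriv h 0) (at 0)"
    using DERIV_deriv_iff_field_differentiable[THEN iffD2, OF analytic_on_imp_differentiable_at[OF h(1)]]
    by (simp add: has_field_derivative_iff)
  then have "\<not> is_pole (\<lambda>u. (h u - h 0) / u) 0"
    using is_pole_def not_tendsto_and_filterlim_at_infinity trivial_limit_at by metis
  moreover have "(\<lambda>u. (h u - h 0) / u) meromorphic_on {0}"
    using analytic_on_imp_meromorphic_on[OF h(1)] by (intro meromorphic_intros)
  ultimately have "regular_germ (\<lambda>u. (h u - h 0) / u) 0"
    by (simp add: regular_germ_iff_meromorphic)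
  moreover have "eventually (\<lambda>u. (h u - h 0) / u = u ^ n * ?f u) (at 0)"
    using h(2) nz
  proof eventually_elim
    case (elim u)
    then show ?case by (simp add: field_simps flip: elim(1))
  qed
  ultimately have "regular_germ (\<lambda>u. u ^ n * ?f u) 0"
    by (simp only: regular_germ_cong)
  from Suc.IH[OF this] obtain Q where "regular_germ (\<lambda>u. ?f u - poly Q (1 / u)) 0" ..
  then have "regular_germ (\<lambda>u. f u - poly (Q + monom (h 0) (Suc n)) (1 / u)) 0"
    by (simp add: poly_monom power_divide algebra_simps)
  then show ?case ..
qed

lemma ex_principal_part:
  assumes f: "f meromorphic_on {0}"
  shows "\<exists>Q. regular_germ (\<lambda>u. f u - poly Q (1 / u)) 0"
proof (cases "is_pole f 0")
  case False
  then show ?thesis using f by (intro exI[of _ 0]) (simp add: regular_germ_iff_meromorphic)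
next
  case True
  obtain S where S: "open S" "0 \<in> S" "f holomorphic_on S - {0}"
    using f by (metis meromorphic_at_iff isolated_singularity_at_iff_analytic_nhd
        analytic_imp_holomorphic)
  define n where "n = nat (- zorder f 0)"
  obtain r where r: "r > 0" "zor_poly f 0 holomorphic_on cball 0 r"
    "\<And>w. w \<in> cball 0 r - {0} \<Longrightarrow> f w = zor_poly f 0 w / w ^ n"
    using zorder_exist_pole[OF S(3,1,2) True] unfolding n_def by auto
  have "zor_poly f 0 analytic_on {0}"
    using r(1,2) unfolding analytic_at
    by (intro exI[of _ "ball 0 r"]) (auto intro: holomorphic_on_subset)
  moreover have "eventually (\<lambda>u. u ^ n * f u = zor_poly f 0 u) (at 0)"
    unfolding eventually_at using r by (intro exI[of _ r]) auto
  ultimately have "regular_germ (\<lambda>u. u ^ n * f u) 0" unfolding regular_germ_def by blast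
  then show ?thesis by (rule ex_principal_part_order)
qed

lemma coord_local_param: "u \<noteq> 0 \<Longrightarrow> coord q (local_param q u) = 1 / u"
  by (cases q) auto

lemma coord_regular:
  assumes "p \<noteq> q"
  shows "regular_germ (\<lambda>u. coord q (local_param p u)) 0"
proof -
  have nz: "eventually (\<lambda>u::complex. u \<noteq> 0) (at 0)" by (simp add: eventually_at_filter)
  show ?thesis
  proof (cases q)
    case None
    then obtain a where "p = Some a" using assms by (cases p) auto
    then show ?thesis using None by (auto intro!: regular_germ_analytic analytic_intros)
  next
    case (Some b)
    show ?thesis
    proof (cases p)
      case (Some a)
      then show ?thesis using assms \<open>q = Some b\<close>
        by (auto intro!: regular_germ_analytic analytic_intros)
    next
      case None
      have "(\<lambda>u. u / (1 - b * u)) analytic_on {0}" by (auto intro!: analytic_intros)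
      moreover have "eventually (\<lambda>u. coord q (local_param p u) = u / (1 - b * u)) (at 0)"
        using nz by eventually_elim (use None Some in \<open>auto simp: divide_simps\<close>)
      ultimately show ?thesis unfolding regular_germ_def by blast
    qed
  qed
qed

lemma regular_germ_poly: "regular_germ f z \<Longrightarrow> regular_germ (\<lambda>u. poly Q (f u)) z"
  by (induction Q) (auto intro!: regular_germ_add regular_germ_mult regular_germ_const)

text \<open>
  A polynomial in the coordinate with pole \<open>q\<close> has its only pole at \<open>q\<close>, so it can serve as a
  principal part at \<open>q\<close> without disturbing any other point.
\<close>

lemma reg_funs_poly_coord: "(\<lambda>p. poly Q (coord q p)) \<in> reg_funs (- {q})"
proof -
  have reg: "regular_germ (\<lambda>u. poly Q (coord q (local_param p u))) 0" if "p \<noteq> q" for p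
    using coord_regular[OF that] by (rule regular_germ_poly)
  have "(\<lambda>u. poly Q (1 / u)) meromorphic_on {0}"
    by (induction Q) (auto intro!: meromorphic_intros)
  moreover have "eventually (\<lambda>u. poly Q (1 / u) = poly Q (coord q (local_param q u))) (at 0)"
    by (simp add: eventually_at_filter coord_local_param)
  ultimately have "(\<lambda>u. poly Q (coord q (local_param q u))) meromorphic_on {0}"
    using meromorphic_on_cong[of "{0}" "\<lambda>u. poly Q (1 / u)"
        "\<lambda>u. poly Q (coord q (local_param q u))" "{0}"] by simp
  then have "(\<lambda>u. poly Q (coord q (local_param p u))) meromorphic_on {0}" for p
    using reg[of p] by (cases "p = q") (auto simp: regular_germ_iff_meromorphic)
  then show ?thesis using reg by (auto simp: reg_funs_iff mero_fun_def)
qed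

lemma mero_fun_finite_poles:
  assumes "mero_fun \<phi>"
  shows "finite {p. \<not> regular_germ (\<lambda>u. \<phi> (local_param p u)) 0}"
proof -
  have "eventually (\<lambda>z. regular_germ (\<lambda>u. \<phi> (local_param (Some z) u)) 0) cofinite"
    using mero_fun_analytic[OF assms]
  proof eventually_elim
    case (elim z)
    have "((\<lambda>w. \<phi> (Some w)) \<circ> (\<lambda>u. z + u)) analytic_on {0}"
      using elim by (intro analytic_on_compose analytic_intros) auto
    then show ?case by (auto simp: o_def intro: regular_germ_analytic)
  qed
  then show ?thesis
    unfolding cofinite_Some_iff[of "\<lambda>p. regular_germ (\<lambda>u. \<phi> (local_param p u)) 0"]
    by (simp add: eventually_cofinite)
qed

lemma split_principal_parts:
  assumes "finite S" "mero_fun \<phi>"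
  shows "\<exists>\<phi>1. \<phi>1 \<in> reg_funs (- S) \<and> (\<lambda>p. \<phi> p - \<phi>1 p) \<in> reg_funs S"
  using assms(1)
proof (induction S)
  case empty
  then show ?case
    using assms(2) by (intro exI[of _ "\<lambda>p. 0"]) (simp add: reg_funs_const reg_funs_iff[of _ "{}"])
next
  case (insert s S)
  then obtain \<phi>1 where \<phi>1: "\<phi>1 \<in> reg_funs (- S)" "(\<lambda>p. \<phi> p - \<phi>1 p) \<in> reg_funs S" by blast
  then obtain Q where Q: "regular_germ (\<lambda>u. (\<phi> (local_param s u) - \<phi>1 (local_param s u)) - poly Q (1 / u)) 0"
    using ex_principal_part[of "\<lambda>u. \<phi> (local_param s u) - \<phi>1 (local_param s u)"]
    by (auto simp: reg_funs_iff mero_fun_def)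
  let ?\<pi> = "\<lambda>p. poly Q (coord s p)"
  have \<pi>: "?\<pi> \<in> reg_funs (- {s})" by (rule reg_funs_poly_coord)
  have "(\<lambda>p. (\<phi> p - \<phi>1 p) - ?\<pi> p) \<in> reg_funs (insert s S)"
  proof -
    have "(\<lambda>p. (\<phi> p - \<phi>1 p) - ?\<pi> p) \<in> reg_funs S"
      using insert.hyps by (intro reg_funs_diff[OF \<phi>1(2)] reg_funs_mono[OF \<pi>]) auto
    moreover have "regular_germ (\<lambda>u. (\<phi> (local_param s u) - \<phi>1 (local_param s u)) -
        poly Q (coord s (local_param s u))) 0"
      using Q by (subst regular_germ_cong) (auto simp: eventually_at_filter coord_local_param)
    ultimately show ?thesis by (auto simp: reg_funs_iff)
  qed
  moreover have "(\<lambda>p. \<phi>1 p + ?\<pi> p) \<in> reg_funs (- insert s S)"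
    by (intro reg_funs_add reg_funs_mono[OF \<phi>1(1)] reg_funs_mono[OF \<pi>]) auto
  ultimately show ?case
    by (intro exI[of _ "\<lambda>p. \<phi>1 p + ?\<pi> p"]) (simp add: algebra_simps)
qed

text \<open>
  The principal parts at the poles outside \<open>A1\<close> are collected in the first summand. The remaining poles lie in
  \<open>A1\<close>, hence not in \<open>A2\<close>, as \<open>\<phi>\<close> is regular on the intersection.
\<close>

lemma ex_splitting:
  assumes \<phi>: "\<phi> \<in> reg_funs (A1 \<inter> A2)" and A: "A1 \<union> A2 = UNIV"
  shows "\<exists>\<phi>1\<in>reg_funs A1. \<exists>\<phi>2\<in>reg_funs A2. \<forall>p. \<phi> p = \<phi>1 p + \<phi>2 p"
proof -
  have mero: "mero_fun \<phi>" using \<phi> by (simp add: reg_funs_iff)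
  let ?S = "{p. \<not> regular_germ (\<lambda>u. \<phi> (local_param p u)) 0} - A1"
  obtain \<phi>1 where \<phi>1: "\<phi>1 \<in> reg_funs (- ?S)" "(\<lambda>p. \<phi> p - \<phi>1 p) \<in> reg_funs ?S"
    using split_principal_parts[of ?S \<phi>] mero_fun_finite_poles[OF mero] mero by auto
  have "regular_germ (\<lambda>u. \<phi> (local_param p u) - \<phi>1 (local_param p u)) 0" if "p \<in> A2" for p
  proof (cases "p \<in> ?S")
    case True
    then show ?thesis using \<phi>1(2) by (auto simp: reg_funs_iff)
  next
    case False
    then have "\<phi> \<in> reg_funs {p}" "\<phi>1 \<in> reg_funs {p}"
      using that \<phi> \<phi>1(1) by (auto simp: reg_funs_iff)
    then show ?thesis using reg_funs_diff[of \<phi> "{p}" \<phi>1] by (auto simp: reg_funs_iff)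
  qed
  then have "(\<lambda>p. \<phi> p - \<phi>1 p) \<in> reg_funs A2"
    using \<phi>1(2) by (auto simp: reg_funs_iff)
  moreover have "\<phi>1 \<in> reg_funs A1" using \<phi>1(1) by (rule reg_funs_mono) auto
  ultimately show ?thesis by (intro bexI[of _ \<phi>1] bexI[of _ "\<lambda>p. \<phi> p - \<phi>1 p"]) auto
qed

lemma Liouville_cp1:
  assumes g: "g \<in> reg_funs UNIV"
  shows "\<exists>c. eventually (\<lambda>p. g p = c) cofinite"
proof -
  define G where "G = remove_sings (\<lambda>z. g (Some z))"
  have "G analytic_on {a}" for a
  proof -
    have "regular_germ (\<lambda>u. g (local_param (Some a) u)) (a - a)"
      using g by (auto simp: reg_funs_iff simp del: local_param.simps)
    then have "regular_germ (\<lambda>z. g (local_param (Some a) (z - a))) a"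
      by (intro regular_germ_compose[of "\<lambda>z. z - a"])
        (auto intro!: analytic_intros simp: eventually_at_filter simp del: local_param.simps)
    then show ?thesis
      unfolding G_def by (intro remove_sings_regular_germ) (simp_all add: regular_germ_iff_meromorphic)
  qed
  then have hol: "G holomorphic_on UNIV"
    using analytic_imp_holomorphic analytic_on_analytic_at by blast
  have ev: "eventually (\<lambda>z. g (Some z) = G z) cofinite"
    using mero_fun_analytic[of g] g unfolding G_def reg_funs_iff
    by (auto elim!: eventually_mono)
  obtain h where h: "h analytic_on {0}" "eventually (\<lambda>u. g (local_param None u) = h u) (at 0)"
    using g unfolding reg_funs_iff regular_germ_def by blast
  have "(h \<longlongrightarrow> h 0) (at 0)"
    using analytic_at_imp_isCont[OF h(1)] by (simp add: isCont_def)
  moreover have "eventually (\<lambda>u. h u = (G \<circ> inverse) u) (at 0)"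
  proof -
    have "eventually (\<lambda>p. case p of None \<Rightarrow> True | Some z \<Rightarrow> g (Some z) = G z) cofinite"
      using ev by (simp flip: cofinite_Some_iff)
    from cofinite_imp_local[OF this, of None] h(2)
    have "eventually (\<lambda>u. u \<noteq> 0 \<longrightarrow> h u = (G \<circ> inverse) u) (at 0)"
      by eventually_elim (auto simp: inverse_eq_divide)
    then show ?thesis by (simp add: eventually_at_filter)
  qed
  ultimately have "((G \<circ> inverse) \<longlongrightarrow> h 0) (at 0)" by (rule Lim_transform_eventually)
  then have "G z = h 0" for z
    using Liouville_weak[OF hol] by (simp add: lim_at_infinity_0)
  then have "eventually (\<lambda>p. g p = h 0) cofinite"
    using ev by (simp flip: cofinite_Some_iff)
  then show ?thesis ..
qed

section \<open>Classes of residue-free forms\<close>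

text \<open>
  Equality of classes of forms is imposed near the finite points only. It extends to infinity by the
  identity theorem: the difference is meromorphic there and vanishes on points arbitrarily close to infinity,
  so it vanishes in a punctured neighbourhood.
\<close>

lemma form_eq_cofinite:
  assumes "form_eq f g"
  shows "eventually (\<lambda>z. f z = g z) cofinite"
proof -
  let ?d = "\<lambda>z. f z + (-1) * g z"
  have mero: "mero_form f" "mero_form g" using assms by (auto simp: form_eq_def residue_free_def)
  then have d: "form_at ?d None meromorphic_on {0}"
    unfolding form_at_add form_at_cmult by (intro meromorphic_intros)
      (use mero in \<open>simp_all add: mero_form_def del: form_at.simps\<close>)
  have "frequently (\<lambda>u. form_at ?d None u = 0) (at 0)"
    unfolding frequently_def
  proof
    assume "eventually (\<lambda>u. form_at ?d None u \<noteq> 0) (at 0)"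
    then obtain r where r: "r > 0" "\<And>u. u \<noteq> 0 \<Longrightarrow> norm u < r \<Longrightarrow> form_at ?d None u \<noteq> 0"
      by (auto simp: eventually_at)
    \<comment> \<open>The punctured disc of radius \<open>r\<close> around infinity is \<open>norm z > 1 / r\<close>, and \<open>2 / r\<close> is a point of it.\<close>
    define z where "z = complex_of_real (2 / r)"
    have z: "z \<noteq> 0" "norm z = 2 / r" using r(1) by (auto simp: z_def norm_divide)
    have "eventually (\<lambda>w. f w = g w) (at z)" using assms by (auto simp: form_eq_def)
    moreover have "eventually (\<lambda>w. norm w > 1 / r) (at z)"
      using z r(1) by (intro order_tendstoD[OF tendsto_norm[OF tendsto_ident_at]]) (auto simp: field_simps)
    ultimately have "eventually (\<lambda>w. f w = g w \<and> norm w > 1 / r) (at z)"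
      by (rule eventually_conj)
    then obtain w where w: "f w = g w" "norm w > 1 / r"
      using eventually_happens'[of "at z"] by auto
    have "0 < norm w" using w(2) r(1) by (smt (verit) divide_pos_pos)
    then have "1 / w \<noteq> 0" "norm (1 / w) < r" using w r(1) by (auto simp: norm_divide field_simps)
    from r(2)[OF this] w show False by simp
  qed
  then have "eventually (\<lambda>u. form_at ?d None u = 0) (at 0)"
    using d unfolding meromorphic_at_iff by (metis not_essential_frequently_0_imp_eventually_0)
  then have inf: "eventually (\<lambda>u. u \<noteq> 0 \<longrightarrow> f (1 / u) = g (1 / u)) (at 0)"
    by eventually_elim auto
  have "eventually (\<lambda>p. case p of None \<Rightarrow> True | Some z \<Rightarrow> f z = g z) cofinite"
  proof (rule cofinite_if_local)
    fix p
    show "eventually (\<lambda>u. case local_param p u of None \<Rightarrow> True | Some z \<Rightarrow> f z = g z) (at 0)"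
    proof (cases p)
      case None
      then show ?thesis using inf by (auto elim: eventually_mono)
    next
      case (Some a)
      have "eventually (\<lambda>w. f w = g w) (at a)" using assms by (auto simp: form_eq_def)
      then show ?thesis
        unfolding Some by (subst eventually_at_Some_iff[where P = "\<lambda>p. case p of None \<Rightarrow> True | Some z \<Rightarrow> f z = g z"]) simp
    qed
  qed
  then show ?thesis by (simp flip: cofinite_Some_iff)
qed

lemma cofinite_imp_at: "eventually P cofinite \<Longrightarrow> eventually P (at (z::complex))"
  unfolding eventually_cofinite by (drule islimpt_finite[of _ z]) (simp add: islimpt_iff_eventually)

lemma rep_kform_abs:
  assumes "residue_free f"
  shows "eventually (\<lambda>z. rep_kform (abs_kform f) z = f z) cofinite"
proof -
  have "form_eq f f" using assms by (simp add: form_eq_def)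
  then have "form_eq (rep_kform (abs_kform f)) f" by (rule Quotient3_rep_abs[OF Quotient3_kform])
  then show ?thesis by (rule form_eq_cofinite)
qed

lemma form_eq_rep: "form_eq (rep_kform \<alpha>) (rep_kform \<alpha>)"
  by (rule Quotient3_rep_reflp[OF Quotient3_kform])

lemma rep_kform_add: "eventually (\<lambda>z. rep_kform (\<alpha> + \<beta>) z = rep_kform \<alpha> z + rep_kform \<beta> z) cofinite"
proof -
  have "\<alpha> + \<beta> = abs_kform (\<lambda>z. rep_kform \<alpha> z + rep_kform \<beta> z)"
    using plus_kform.abs_eq[OF form_eq_rep form_eq_rep, of \<alpha> \<beta>]
    by (simp add: Quotient3_abs_rep[OF Quotient3_kform])
  then show ?thesis
    using rep_kform_abs residue_free_add form_eq_rep unfolding form_eq_def by metis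
qed

lemma rep_kform_scale: "eventually (\<lambda>z. rep_kform (c *\<^sub>C \<alpha>) z = c * rep_kform \<alpha> z) cofinite"
proof -
  have "c *\<^sub>C \<alpha> = abs_kform (\<lambda>z. c * rep_kform \<alpha> z)"
    using cscale_kform.abs_eq[OF form_eq_rep, of c \<alpha>]
    by (simp add: Quotient3_abs_rep[OF Quotient3_kform])
  then show ?thesis
    using rep_kform_abs residue_free_cmult form_eq_rep unfolding form_eq_def by metis
qed

lemma rep_kform_d:
  "mero_fun \<phi> \<Longrightarrow> eventually (\<lambda>z. rep_kform (d_kform \<phi>) z = dcoeff \<phi> z) cofinite"
  unfolding d_kform_def by (intro rep_kform_abs residue_free_dcoeff)

lemma d_kform_eqI:
  assumes "mero_fun \<phi>" "mero_fun \<psi>" "eventually (\<lambda>z. dcoeff \<phi> z = dcoeff \<psi> z) cofinite"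
  shows "d_kform \<phi> = d_kform \<psi>"
proof -
  have "form_eq (dcoeff \<phi>) (dcoeff \<psi>)"
    using assms by (auto simp: form_eq_def residue_free_dcoeff intro: cofinite_imp_at)
  then show ?thesis unfolding d_kform_def using Quotient3_rel_abs[OF Quotient3_kform] by metis
qed

lemma kforms_regular_on_iff: "\<alpha> \<in> kforms_regular_on A \<longleftrightarrow> rep_kform \<alpha> \<in> reg_forms A"
  using form_eq_rep[of \<alpha>]
  by (auto simp: kforms_regular_on_def reg_forms_def form_eq_def residue_free_def)

lemma kforms_regular_on_empty: "kforms_regular_on {} = UNIV"
  by (auto simp: kforms_regular_on_def form_regular_on_def)

lemma d_kform_regular: "\<phi> \<in> reg_funs A \<Longrightarrow> d_kform \<phi> \<in> kforms_regular_on A"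
  unfolding kforms_regular_on_iff
  by (rule reg_forms_cong[OF _ reg_forms_dcoeff])
    (use rep_kform_d[of \<phi>] in \<open>auto simp: reg_funs_iff eq_commute\<close>)

lemma kforms_regular_on_subspace: "module.subspace cscale (kforms_regular_on A)"
proof -
  interpret vector_space "cscale :: complex \<Rightarrow> kform \<Rightarrow> kform" by (rule vector_space_cscale)
  have cong: "g \<in> reg_forms A" if "f \<in> reg_forms A" "eventually (\<lambda>z. g z = f z) cofinite" for f g
    using reg_forms_cong[of f g A] that by (simp add: eq_commute)
  show ?thesis
    unfolding subspace_def
  proof (intro conjI ballI allI)
    have "(\<lambda>z. 0) \<in> reg_forms A"
      by (auto simp: reg_forms_iff mero_form_def form_at_zero regular_germ_const)
    then show "0 \<in> kforms_regular_on A"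
      unfolding kforms_regular_on_iff zero_kform_def
      by (rule cong) (rule rep_kform_abs[OF residue_free_zero])
  next
    fix \<alpha> \<beta> assume "\<alpha> \<in> kforms_regular_on A" "\<beta> \<in> kforms_regular_on A"
    then show "\<alpha> + \<beta> \<in> kforms_regular_on A"
      unfolding kforms_regular_on_iff by (intro cong[OF reg_forms_add rep_kform_add])
  next
    fix c \<alpha> assume "\<alpha> \<in> kforms_regular_on A"
    then show "c *\<^sub>C \<alpha> \<in> kforms_regular_on A"
      unfolding kforms_regular_on_iff by (intro cong[OF reg_forms_cmult rep_kform_scale])
  qed
qed

section \<open>The commutator for an abstract residue functional\<close>

text \<open>
  The properties of a residue or of a boundary integral on which the commutation relation rests. The two
  vanishing hypotheses are a residue theorem for forms whose poles lie on one side.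
\<close>

locale residue_pairing =
  fixes A1 A2 :: "cp1 set" and J :: "(complex \<Rightarrow> complex) \<Rightarrow> complex"
  assumes cover: "A1 \<union> A2 = UNIV"
    and J_cong: "f \<in> reg_forms (A1 \<inter> A2) \<Longrightarrow> eventually (\<lambda>z. f z = g z) cofinite \<Longrightarrow> J f = J g"
    and J_add: "f \<in> reg_forms (A1 \<inter> A2) \<Longrightarrow> g \<in> reg_forms (A1 \<inter> A2) \<Longrightarrow>
      J (\<lambda>z. f z + g z) = J f + J g"
    and J_cmult: "f \<in> reg_forms (A1 \<inter> A2) \<Longrightarrow> J (\<lambda>z. c * f z) = c * J f"
    and J_reg1: "f \<in> reg_forms A1 \<Longrightarrow> J f = 0"
    and J_reg2: "f \<in> reg_forms A2 \<Longrightarrow> J f = 0"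
begin

definition V :: "kform set" where "V = kforms_regular_on (A1 \<inter> A2)"

definition coeff :: "(cp1 \<Rightarrow> complex) \<Rightarrow> kform \<Rightarrow> complex" where
  "coeff \<phi> \<alpha> = J (fun_times_form \<phi> (rep_kform \<alpha>))"

text \<open>
  The common shape of the three families of operators, which are recovered by inserting the particular sets
  and functional.
\<close>

definition Op :: "(cp1 \<Rightarrow> complex) \<Rightarrow> W \<Rightarrow> W" where
  "Op = split_operator A1 A2 (\<lambda>\<phi>. symalg_operator V (coeff \<phi>) (d_kform \<phi>))
     (\<lambda>\<phi>. symalg_operator V (coeff \<phi>) 0)"

lemma reg1: "\<phi> \<in> reg_funs A1 \<Longrightarrow> \<phi> \<in> reg_funs (A1 \<inter> A2)"
  by (rule reg_funs_mono) auto

lemma reg2: "\<phi> \<in> reg_funs A2 \<Longrightarrow> \<phi> \<in> reg_funs (A1 \<inter> A2)"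
  by (rule reg_funs_mono) auto

lemma V_rep: "\<alpha> \<in> V \<Longrightarrow> rep_kform \<alpha> \<in> reg_forms (A1 \<inter> A2)"
  by (simp add: V_def kforms_regular_on_iff)

lemma J_fun_add:
  assumes "\<phi> \<in> reg_funs (A1 \<inter> A2)" "\<psi> \<in> reg_funs (A1 \<inter> A2)" "f \<in> reg_forms (A1 \<inter> A2)"
    and "\<And>p. \<theta> p = \<phi> p + \<psi> p"
  shows "J (fun_times_form \<theta> f) = J (fun_times_form \<phi> f) + J (fun_times_form \<psi> f)"
proof -
  have "fun_times_form \<theta> f = (\<lambda>z. fun_times_form \<phi> f z + fun_times_form \<psi> f z)"
    by (simp add: fun_times_form_def fun_eq_iff assms(4) algebra_simps)
  then show ?thesis using assms by (simp add: J_add reg_forms_fun_times)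
qed

lemma J_form_add:
  assumes "\<phi> \<in> reg_funs (A1 \<inter> A2)" "f \<in> reg_forms (A1 \<inter> A2)" "g \<in> reg_forms (A1 \<inter> A2)"
    and ev: "eventually (\<lambda>z. h z = f z + g z) cofinite"
  shows "J (fun_times_form \<phi> h) = J (fun_times_form \<phi> f) + J (fun_times_form \<phi> g)"
proof -
  have "J (\<lambda>z. fun_times_form \<phi> f z + fun_times_form \<phi> g z) = J (fun_times_form \<phi> h)"
    using ev by (intro J_cong reg_forms_add reg_forms_fun_times assms)
      (auto elim!: eventually_mono simp: fun_times_form_def algebra_simps)
  then show ?thesis using assms by (simp add: J_add reg_forms_fun_times)
qed

lemma J_form_cong:
  assumes "\<phi> \<in> reg_funs (A1 \<inter> A2)" "f \<in> reg_forms (A1 \<inter> A2)"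
    and ev: "eventually (\<lambda>z. f z = g z) cofinite"
  shows "J (fun_times_form \<phi> f) = J (fun_times_form \<phi> g)"
  using ev by (intro J_cong reg_forms_fun_times assms)
    (auto elim!: eventually_mono simp: fun_times_form_def)

lemma coeff_functional:
  assumes \<phi>: "\<phi> \<in> reg_funs (A1 \<inter> A2)"
  shows "\<exists>d. linear_functional d \<and> (\<forall>\<alpha>\<in>V. d \<alpha> = coeff \<phi> \<alpha>)"
proof (rule linear_functional_extend)
  show "module.subspace cscale V" unfolding V_def by (rule kforms_regular_on_subspace)
next
  fix \<alpha> \<beta> assume "\<alpha> \<in> V" "\<beta> \<in> V"
  then show "coeff \<phi> (\<alpha> + \<beta>) = coeff \<phi> \<alpha> + coeff \<phi> \<beta>"
    unfolding coeff_def by (intro J_form_add[OF \<phi>] V_rep rep_kform_add)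
next
  fix a \<alpha> assume \<alpha>: "\<alpha> \<in> V"
  have "J (\<lambda>z. a * fun_times_form \<phi> (rep_kform \<alpha>) z) = J (fun_times_form \<phi> (rep_kform (a *\<^sub>C \<alpha>)))"
    using rep_kform_scale[of a \<alpha>]
    by (intro J_cong reg_forms_cmult reg_forms_fun_times \<phi> V_rep \<alpha>)
      (auto elim!: eventually_mono simp: fun_times_form_def)
  then show "coeff \<phi> (a *\<^sub>C \<alpha>) = a * coeff \<phi> \<alpha>"
    unfolding coeff_def using \<alpha> \<phi> by (simp add: J_cmult reg_forms_fun_times V_rep)
qed

lemma coeff_add:
  assumes "\<phi>1 \<in> reg_funs A1" "\<phi>2 \<in> reg_funs A2" "\<And>p. \<phi> p = \<phi>1 p + \<phi>2 p" "\<alpha> \<in> V"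
  shows "coeff \<phi> \<alpha> = coeff \<phi>1 \<alpha> + coeff \<phi>2 \<alpha>"
  unfolding coeff_def using assms by (intro J_fun_add reg1 reg2 V_rep)

lemma d_in_V: "\<phi> \<in> reg_funs (A1 \<inter> A2) \<Longrightarrow> d_kform \<phi> \<in> V"
  unfolding V_def by (rule d_kform_regular)

lemma zero_in_V: "0 \<in> V"
proof -
  interpret vector_space "cscale :: complex \<Rightarrow> kform \<Rightarrow> kform" by (rule vector_space_cscale)
  show ?thesis unfolding V_def using kforms_regular_on_subspace by (rule subspace_0)
qed

text \<open>
  The two summands of an operator contract with \<open>\<phi>1\<close> and with \<open>\<phi>2\<close>; on \<open>V\<close> these contractions add up to
  the one with \<open>\<phi>\<close>. Only \<open>d\<phi>1\<close> still remembers the splitting.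
\<close>

lemma splitting_operators:
  assumes \<phi>1: "\<phi>1 \<in> reg_funs A1" and \<phi>2: "\<phi>2 \<in> reg_funs A2" and \<phi>: "\<And>p. \<phi> p = \<phi>1 p + \<phi>2 p"
    and \<delta>: "sym_derivation d \<delta>" and d: "\<And>\<alpha>. \<alpha> \<in> V \<Longrightarrow> d \<alpha> = coeff \<phi> \<alpha>"
  shows "symalg_operator V (coeff \<phi>1) (d_kform \<phi>1) x + symalg_operator V (coeff \<phi>2) 0 x =
    (if x \<in> symalg_on V then \<delta> x + sym_gen (d_kform \<phi>1) * x else 0)"
proof -
  obtain d1 d2 where d12: "linear_functional d1" "\<And>\<alpha>. \<alpha> \<in> V \<Longrightarrow> d1 \<alpha> = coeff \<phi>1 \<alpha>"
    "linear_functional d2" "\<And>\<alpha>. \<alpha> \<in> V \<Longrightarrow> d2 \<alpha> = coeff \<phi>2 \<alpha>"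
    using coeff_functional[OF reg1[OF \<phi>1]] coeff_functional[OF reg2[OF \<phi>2]] by metis
  then obtain \<delta>1 \<delta>2 where \<delta>12: "sym_derivation d1 \<delta>1" "sym_derivation d2 \<delta>2"
    using ex_sym_derivation by metis
  have "\<delta> x = \<delta>1 x + \<delta>2 x" if "x \<in> symalg_on V"
    using \<phi>1 \<phi>2 \<phi>
    by (intro sym_derivation_unique[OF \<delta> sym_derivation_plus[OF \<delta>12] _ that])
      (simp add: d d12 coeff_add)
  then show ?thesis
    by (simp add: symalg_operator_eq[OF d_in_V[OF reg1[OF \<phi>1]] \<delta>12(1) d12(2)]
      symalg_operator_eq[OF zero_in_V \<delta>12(2) d12(4)] sym_gen_zero algebra_simps)
qed

text \<open>
  The difference of the first summands is also a difference of the second ones, so it is regular on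
  \<open>A1 \<union> A2\<close>, the whole line, and Liouville's theorem applies.
\<close>

lemma splitting_unique:
  assumes \<phi>1: "\<phi>1 \<in> reg_funs A1" and \<phi>2: "\<phi>2 \<in> reg_funs A2"
    and \<psi>1: "\<psi>1 \<in> reg_funs A1" and \<psi>2: "\<psi>2 \<in> reg_funs A2"
    and eq: "\<And>p. \<phi>1 p + \<phi>2 p = \<psi>1 p + \<psi>2 p"
  shows "d_kform \<phi>1 = d_kform \<psi>1"
proof -
  let ?g = "\<lambda>p. \<phi>1 p - \<psi>1 p"
  have "?g \<in> reg_funs A1" by (intro reg_funs_diff \<phi>1 \<psi>1)
  moreover have "?g = (\<lambda>p. \<psi>2 p - \<phi>2 p)" using eq by (auto simp: fun_eq_iff algebra_simps)
  then have "?g \<in> reg_funs A2" using reg_funs_diff[OF \<psi>2 \<phi>2] by simp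
  ultimately have "?g \<in> reg_funs UNIV" using cover by (auto simp: reg_funs_iff)
  then obtain c where c: "eventually (\<lambda>p. ?g p = c) cofinite" using Liouville_cp1 by blast
  have mero: "mero_fun \<phi>1" "mero_fun \<psi>1" using \<phi>1 \<psi>1 by (auto simp: reg_funs_iff)
  have "finite {z. ?g (Some z) \<noteq> c}"
    using c by (simp add: cofinite_Some_iff[of "\<lambda>p. ?g p = c", symmetric] eventually_cofinite)
  then have op: "open (- {z. ?g (Some z) \<noteq> c})" by (intro open_Compl finite_imp_closed)
  have "eventually (\<lambda>z. z \<in> - {z. ?g (Some z) \<noteq> c}) cofinite"
    using c by (simp flip: cofinite_Some_iff)
  then have "eventually (\<lambda>z. dcoeff \<phi>1 z = dcoeff \<psi>1 z) cofinite"
    using dcoeff_field_derivative[OF mero(2)]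
  proof eventually_elim
    case (elim z)
    have "eventually (\<lambda>w. \<phi>1 (Some w) = \<psi>1 (Some w) + c) (nhds z)"
      using eventually_nhds_in_open[OF op elim(1)] by eventually_elim (auto simp: algebra_simps)
    then have "dcoeff \<phi>1 z = deriv (\<lambda>w. \<psi>1 (Some w) + c) z"
      unfolding dcoeff_def by (intro deriv_cong_ev) auto
    also have "\<dots> = dcoeff \<psi>1 z"
      using elim(2) by (auto intro!: DERIV_imp_deriv derivative_eq_intros)
    finally show ?case .
  qed
  then show ?thesis using d_kform_eqI mero by blast
qed

lemma Op_eq:
  assumes \<phi>1: "\<phi>1 \<in> reg_funs A1" and \<phi>2: "\<phi>2 \<in> reg_funs A2" and \<phi>: "\<And>p. \<phi> p = \<phi>1 p + \<phi>2 p"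
    and \<delta>: "sym_derivation d \<delta>" and d: "\<And>\<alpha>. \<alpha> \<in> V \<Longrightarrow> d \<alpha> = coeff \<phi> \<alpha>"
  shows "Op \<phi> = (\<lambda>x. if x \<in> symalg_on V then \<delta> x + sym_gen (d_kform \<phi>1) * x else 0)"
  unfolding Op_def split_operator_def
proof (rule the_equality)
  let ?T = "\<lambda>x. if x \<in> symalg_on V then \<delta> x + sym_gen (d_kform \<phi>1) * x else 0"
  show "\<exists>\<phi>1 \<phi>2. mero_fun \<phi>1 \<and> fun_regular_on \<phi>1 A1 \<and> mero_fun \<phi>2 \<and> fun_regular_on \<phi>2 A2 \<and>
     (\<forall>p. \<phi> p = \<phi>1 p + \<phi>2 p) \<and>
     (\<forall>x. ?T x = symalg_operator V (coeff \<phi>1) (d_kform \<phi>1) x + symalg_operator V (coeff \<phi>2) 0 x)"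
    using splitting_operators[OF \<phi>1 \<phi>2 \<phi> \<delta> d] \<phi>1 \<phi>2 \<phi>
    by (intro exI[of _ \<phi>1] exI[of _ \<phi>2]) (simp add: reg_funs_def)
next
  fix T
  assume "\<exists>\<phi>1 \<phi>2. mero_fun \<phi>1 \<and> fun_regular_on \<phi>1 A1 \<and> mero_fun \<phi>2 \<and> fun_regular_on \<phi>2 A2 \<and>
     (\<forall>p. \<phi> p = \<phi>1 p + \<phi>2 p) \<and>
     (\<forall>x. T x = symalg_operator V (coeff \<phi>1) (d_kform \<phi>1) x + symalg_operator V (coeff \<phi>2) 0 x)"
  then obtain \<psi>1 \<psi>2 where \<psi>: "\<psi>1 \<in> reg_funs A1" "\<psi>2 \<in> reg_funs A2" "\<And>p. \<phi> p = \<psi>1 p + \<psi>2 p"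
    "\<And>x. T x = symalg_operator V (coeff \<psi>1) (d_kform \<psi>1) x + symalg_operator V (coeff \<psi>2) 0 x"
    by (auto simp: reg_funs_def)
  have "d_kform \<psi>1 = d_kform \<phi>1"
    using \<phi> \<psi>(3) by (intro splitting_unique[OF \<psi>(1,2) \<phi>1 \<phi>2]) simp
  then show "T = (\<lambda>x. if x \<in> symalg_on V then \<delta> x + sym_gen (d_kform \<phi>1) * x else 0)"
    using splitting_operators[OF \<psi>(1-3) \<delta> d] by (auto simp: fun_eq_iff \<psi>(4))
qed

definition pairing :: "(cp1 \<Rightarrow> complex) \<Rightarrow> (cp1 \<Rightarrow> complex) \<Rightarrow> complex" where
  "pairing \<phi> \<psi> = J (fun_times_form \<phi> (dcoeff \<psi>))"

lemma pairing_reg1: "\<phi> \<in> reg_funs A1 \<Longrightarrow> \<psi> \<in> reg_funs A1 \<Longrightarrow> pairing \<phi> \<psi> = 0"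
  unfolding pairing_def by (intro J_reg1 reg_forms_fun_times reg_forms_dcoeff)

lemma pairing_reg2: "\<phi> \<in> reg_funs A2 \<Longrightarrow> \<psi> \<in> reg_funs A2 \<Longrightarrow> pairing \<phi> \<psi> = 0"
  unfolding pairing_def by (intro J_reg2 reg_forms_fun_times reg_forms_dcoeff)

lemma pairing_add_left:
  assumes "\<phi>1 \<in> reg_funs (A1 \<inter> A2)" "\<phi>2 \<in> reg_funs (A1 \<inter> A2)" "\<psi> \<in> reg_funs (A1 \<inter> A2)"
    "\<And>p. \<phi> p = \<phi>1 p + \<phi>2 p"
  shows "pairing \<phi> \<psi> = pairing \<phi>1 \<psi> + pairing \<phi>2 \<psi>"
  unfolding pairing_def using assms by (intro J_fun_add reg_forms_dcoeff)

lemma pairing_add_right: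
  assumes "\<phi> \<in> reg_funs (A1 \<inter> A2)" "\<psi>1 \<in> reg_funs (A1 \<inter> A2)" "\<psi>2 \<in> reg_funs (A1 \<inter> A2)"
    "\<And>p. \<psi> p = \<psi>1 p + \<psi>2 p"
  shows "pairing \<phi> \<psi> = pairing \<phi> \<psi>1 + pairing \<phi> \<psi>2"
proof -
  have "\<psi> = (\<lambda>p. \<psi>1 p + \<psi>2 p)" using assms(4) by auto
  then show ?thesis
    unfolding pairing_def using assms dcoeff_add[of \<psi>1 \<psi>2]
    by (intro J_form_add reg_forms_dcoeff) (auto simp: reg_funs_iff)
qed

text \<open>
  This replaces the fundamental theorem of calculus: after splitting, both differentials are regular on one of
  the sets on whose forms \<open>J\<close> vanishes.
\<close>

lemma pairing_exact:
  assumes "\<phi> \<in> reg_funs (A1 \<inter> A2)"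
  shows "pairing (\<lambda>p. 1) \<phi> = 0"
proof -
  obtain \<phi>1 \<phi>2 where \<phi>: "\<phi>1 \<in> reg_funs A1" "\<phi>2 \<in> reg_funs A2" "\<And>p. \<phi> p = \<phi>1 p + \<phi>2 p"
    using ex_splitting[OF assms cover] by metis
  then have "pairing (\<lambda>p. 1) \<phi> = pairing (\<lambda>p. 1) \<phi>1 + pairing (\<lambda>p. 1) \<phi>2"
    by (intro pairing_add_right reg_funs_const reg1 reg2)
  then show ?thesis using \<phi> by (simp add: pairing_reg1 pairing_reg2 reg_funs_const)
qed

lemma pairing_antisym:
  assumes \<phi>: "\<phi> \<in> reg_funs (A1 \<inter> A2)" and \<psi>: "\<psi> \<in> reg_funs (A1 \<inter> A2)"
  shows "pairing \<phi> \<psi> = - pairing \<psi> \<phi>"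
proof -
  have "pairing \<phi> \<psi> + pairing \<psi> \<phi> =
      J (\<lambda>z. fun_times_form \<phi> (dcoeff \<psi>) z + fun_times_form \<psi> (dcoeff \<phi>) z)"
    unfolding pairing_def using assms by (intro J_add[symmetric] reg_forms_fun_times reg_forms_dcoeff)
  also have "\<dots> = pairing (\<lambda>p. 1) (\<lambda>p. \<phi> p * \<psi> p)"
    unfolding pairing_def
  proof (rule J_cong)
    show "(\<lambda>z. fun_times_form \<phi> (dcoeff \<psi>) z + fun_times_form \<psi> (dcoeff \<phi>) z) \<in> reg_forms (A1 \<inter> A2)"
      using assms by (intro reg_forms_add reg_forms_fun_times reg_forms_dcoeff)
    show "eventually (\<lambda>z. fun_times_form \<phi> (dcoeff \<psi>) z + fun_times_form \<psi> (dcoeff \<phi>) z =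
        fun_times_form (\<lambda>p. 1) (dcoeff (\<lambda>p. \<phi> p * \<psi> p)) z) cofinite"
      using dcoeff_mult[of \<phi> \<psi>] assms
      by (auto elim!: eventually_mono simp: fun_times_form_def reg_funs_iff)
  qed
  also have "\<dots> = 0" by (intro pairing_exact reg_funs_mult assms)
  finally show ?thesis by (simp add: add_eq_0_iff)
qed

lemma coeff_d:
  assumes "\<phi> \<in> reg_funs (A1 \<inter> A2)" "\<psi> \<in> reg_funs (A1 \<inter> A2)"
  shows "coeff \<phi> (d_kform \<psi>) = pairing \<phi> \<psi>"
  unfolding coeff_def pairing_def using assms rep_kform_d[of \<psi>]
  by (intro J_form_cong V_rep d_in_V) (auto simp: reg_funs_iff)

text \<open>
  The Heisenberg relation gives \<open>J(\<phi> d\<psi>1) - J(\<psi> d\<phi>1)\<close>. Expanding in the summands of \<open>\<phi>\<close> and \<open>\<psi>\<close>, the terms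
  with equal indices vanish, and antisymmetry turns \<open>- J(\<psi>2 d\<phi>1)\<close> into \<open>J(\<phi>1 d\<psi>2)\<close>.
\<close>

theorem commutator:
  assumes \<phi>: "\<phi> \<in> reg_funs (A1 \<inter> A2)" and \<psi>: "\<psi> \<in> reg_funs (A1 \<inter> A2)" and x: "x \<in> symalg_on V"
  shows "Op \<phi> (Op \<psi> x) - Op \<psi> (Op \<phi> x) = J (fun_times_form \<phi> (dcoeff \<psi>)) *\<^sub>C x"
proof -
  obtain \<phi>1 \<phi>2 where \<phi>s: "\<phi>1 \<in> reg_funs A1" "\<phi>2 \<in> reg_funs A2" "\<And>p. \<phi> p = \<phi>1 p + \<phi>2 p"
    using ex_splitting[OF \<phi> cover] by metis
  obtain \<psi>1 \<psi>2 where \<psi>s: "\<psi>1 \<in> reg_funs A1" "\<psi>2 \<in> reg_funs A2" "\<And>p. \<psi> p = \<psi>1 p + \<psi>2 p"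
    using ex_splitting[OF \<psi> cover] by metis
  note reg = \<phi> \<psi> reg1[OF \<phi>s(1)] reg2[OF \<phi>s(2)] reg1[OF \<psi>s(1)] reg2[OF \<psi>s(2)]
  obtain d d' where d: "linear_functional d" "\<And>\<alpha>. \<alpha> \<in> V \<Longrightarrow> d \<alpha> = coeff \<phi> \<alpha>"
    and d': "linear_functional d'" "\<And>\<alpha>. \<alpha> \<in> V \<Longrightarrow> d' \<alpha> = coeff \<psi> \<alpha>"
    using coeff_functional[OF \<phi>] coeff_functional[OF \<psi>] by metis
  obtain \<delta> \<delta>' where \<delta>: "sym_derivation d \<delta>" and \<delta>': "sym_derivation d' \<delta>'"
    using ex_sym_derivation d(1) d'(1) by metis
  have closed: "\<delta> x + sym_gen (d_kform \<phi>1) * x \<in> symalg_on V"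
    "\<delta>' x + sym_gen (d_kform \<psi>1) * x \<in> symalg_on V"
    using x by (intro symalg_on_add symalg_on_gen_mult d_in_V reg sym_derivation_closed[OF \<delta>]
        sym_derivation_closed[OF \<delta>']; assumption)+
  have "Op \<phi> (Op \<psi> x) - Op \<psi> (Op \<phi> x) = (d (d_kform \<psi>1) - d' (d_kform \<phi>1)) *\<^sub>C x"
    using x closed commutator_derivation_plus_multiplication[OF \<delta> \<delta>']
    by (simp add: Op_eq[OF \<phi>s \<delta> d(2)] Op_eq[OF \<psi>s \<delta>' d'(2)])
  also have "d (d_kform \<psi>1) - d' (d_kform \<phi>1) = pairing \<phi> \<psi>1 - pairing \<psi> \<phi>1"
    using reg by (simp add: d d' d_in_V coeff_d)
  also have "\<dots> = pairing \<phi> \<psi>"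
  proof -
    have "pairing \<phi> \<psi> = pairing \<phi> \<psi>1 + pairing \<phi> \<psi>2"
      using reg \<psi>s(3) by (intro pairing_add_right)
    moreover have "pairing \<phi> \<psi>2 = pairing \<phi>1 \<psi>2 + pairing \<phi>2 \<psi>2"
      using reg \<phi>s(3) by (intro pairing_add_left)
    moreover have "pairing \<psi> \<phi>1 = pairing \<psi>1 \<phi>1 + pairing \<psi>2 \<phi>1"
      using reg \<psi>s(3) by (intro pairing_add_left)
    moreover have "pairing \<phi>1 \<psi>2 = - pairing \<psi>2 \<phi>1"
      using reg by (intro pairing_antisym)
    ultimately show ?thesis
      using \<phi>s \<psi>s by (simp add: pairing_reg1 pairing_reg2)
  qed
  finally show ?thesis by (simp add: pairing_def)
qed

end

section \<open>Affine coordinates\<close>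

text \<open>
  The inverse of \<open>coord q\<close>, a parametrization of the complement of \<open>q\<close> by the complex plane.
\<close>

fun affine_pt :: "cp1 \<Rightarrow> complex \<Rightarrow> cp1" where
  "affine_pt None w = Some w"
| "affine_pt (Some b) w = (if w = 0 then None else Some (b + 1 / w))"

text \<open>
  The coefficient of the form \<open>f(z) dz\<close> in the coordinate \<open>w = coord q z\<close>: for \<open>q = Some b\<close> one has
  \<open>z = b + 1 / w\<close> and \<open>dz = - dw / w^2\<close>.
\<close>

fun form_in :: "cp1 \<Rightarrow> (complex \<Rightarrow> complex) \<Rightarrow> complex \<Rightarrow> complex" where
  "form_in None f w = f w"
| "form_in (Some b) f w = - f (b + 1 / w) / w ^ 2"

lemma coord_affine_pt [simp]: "coord q (affine_pt q w) = w"
  by (cases q) auto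

lemma affine_pt_neq [simp]: "affine_pt q w \<noteq> q"
  by (cases q) auto

lemma affine_pt_coord [simp]: "p \<noteq> q \<Longrightarrow> affine_pt q (coord q p) = p"
  by (cases q; cases p) auto

lemma coord_inj: "coord q p = coord q p' \<Longrightarrow> p \<noteq> q \<Longrightarrow> p' \<noteq> q \<Longrightarrow> p = p'"
  by (metis affine_pt_coord)

text \<open>
  Here \<open>h\<close> is the transition from the affine coordinate to the local parameter at the point, and \<open>k\<close> is its
  derivative, so that regularity can be transported from \<open>form_at\<close> to \<open>form_in\<close>.
\<close>

lemma coordinate_change_germ:
  obtains h k where "h analytic_on {w}" "k analytic_on {w}" "h w = 0"
    "eventually (\<lambda>x. h x \<noteq> 0) (at w)"
    "eventually (\<lambda>x. form_in q f x = form_at f (affine_pt q w) (h x) * k x) (at w)"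
proof (cases q)
  case None
  then show ?thesis
    by (intro that[of "\<lambda>x. x - w" "\<lambda>x. 1"])
      (auto intro!: analytic_intros simp: eventually_at_filter)
next
  case (Some b)
  have nz: "eventually (\<lambda>x. x \<noteq> 0) (at w)"
    by (rule eventually_neq_at_within)
  show ?thesis
  proof (cases "w = 0")
    case True
    have "((\<lambda>x. 1 + b * x) \<longlongrightarrow> 1 + b * 0) (at 0)" by (intro tendsto_intros)
    then have ev: "eventually (\<lambda>x. 1 + b * x \<noteq> 0) (at 0)"
      by (rule tendsto_imp_eventually_ne) simp
    show ?thesis
    proof (rule that[of "\<lambda>x. x / (1 + b * x)" "\<lambda>x. 1 / (1 + b * x) ^ 2"])
      show "eventually (\<lambda>x. x / (1 + b * x) \<noteq> 0) (at w)"
        using ev nz unfolding True by eventually_elim simp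
      show "eventually (\<lambda>x. form_in q f x =
          form_at f (affine_pt q w) (x / (1 + b * x)) * (1 / (1 + b * x) ^ 2)) (at w)"
        using ev nz unfolding True
      proof eventually_elim
        case (elim x)
        then have "(1 + b * x) / x = b + 1 / x" by (simp add: field_simps)
        then show ?case using elim Some by (simp add: power_divide)
      qed
    qed (use True in \<open>auto intro!: analytic_intros\<close>)
  next
    case False
    show ?thesis
    proof (rule that[of "\<lambda>x. 1 / x - 1 / w" "\<lambda>x. - 1 / x ^ 2"])
      have "eventually (\<lambda>x. x \<noteq> w) (at w)" by (simp add: eventually_at_filter)
      with nz show "eventually (\<lambda>x. 1 / x - 1 / w \<noteq> 0) (at w)"
        by eventually_elim (use False in auto)
      show "eventually (\<lambda>x. form_in q f x =
          form_at f (affine_pt q w) (1 / x - 1 / w) * (- 1 / x ^ 2)) (at w)"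
        using nz by eventually_elim (use False Some in simp)
    qed (use False in \<open>auto intro!: analytic_intros\<close>)
  qed
qed

lemma regular_germ_form_in:
  assumes "f \<in> reg_forms {affine_pt q w}"
  shows "regular_germ (form_in q f) w"
proof -
  obtain h k where hk: "h analytic_on {w}" "k analytic_on {w}" "h w = 0"
    "eventually (\<lambda>x. h x \<noteq> 0) (at w)"
    and ev: "eventually (\<lambda>x. form_in q f x = form_at f (affine_pt q w) (h x) * k x) (at w)"
    by (rule coordinate_change_germ[of w q f])
  have "regular_germ (\<lambda>x. form_at f (affine_pt q w) (h x)) w"
    using regular_germ_compose[of h w "form_at f (affine_pt q w)"] hk assms
    by (simp add: reg_forms_iff)
  then have "regular_germ (\<lambda>x. form_at f (affine_pt q w) (h x) * k x) w"
    by (intro regular_germ_mult regular_germ_analytic[of k] hk)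
  then show ?thesis using regular_germ_cong[OF ev] by simp
qed

lemma form_at_eq_form_in: "u \<noteq> 0 \<Longrightarrow> form_at f q u = - form_in q f (1 / u) / u ^ 2"
  by (cases q) (auto simp: power_divide)

section \<open>Residues at a point\<close>

text \<open>
  The entire function \<open>H\<close> has a primitive \<open>G\<close>, and \<open>G(1 / u)\<close> is then a primitive in the punctured plane, even
  when the singularity at \<open>0\<close> is essential. So the integral around \<open>0\<close> vanishes.
\<close>

lemma residue_pullback_inverse:
  assumes H: "H holomorphic_on UNIV"
  shows "residue (\<lambda>u. - H (1 / u) / u ^ 2) 0 = 0"
proof -
  obtain G where G: "\<And>w. (G has_field_derivative H w) (at w)"
    using holomorphic_convex_primitive'[of UNIV H] H by auto
  let ?f = "\<lambda>u. - H (1 / u) / u ^ 2"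
  have deriv: "((\<lambda>u. G (1 / u)) has_field_derivative ?f u) (at u)" if "u \<noteq> 0" for u
  proof -
    have "((\<lambda>u. G (1 / u)) has_field_derivative H (1 / u) * (- 1 / u ^ 2)) (at u)"
      by (rule DERIV_chain2[where f = G, OF G])
        (use that in \<open>auto intro!: derivative_eq_intros simp: power2_eq_square\<close>)
    then show ?thesis by simp
  qed
  have "?f holomorphic_on UNIV - {0}"
  proof -
    have "(H \<circ> (\<lambda>u. 1 / u)) holomorphic_on UNIV - {0}"
      by (rule holomorphic_on_compose_gen[OF _ H]) (auto intro!: holomorphic_intros)
    then show ?thesis by (auto intro!: holomorphic_intros simp: o_def)
  qed
  then have "(?f has_contour_integral 2 * pi * \<i> * residue ?f 0) (circlepath 0 1)"
    by (intro base_residue[of UNIV]) auto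
  moreover have "(?f has_contour_integral
      G (1 / pathfinish (circlepath 0 1)) - G (1 / pathstart (circlepath 0 1))) (circlepath 0 1)"
  proof (rule contour_integral_primitive[of "- {0}"])
    show "((\<lambda>u. G (1 / u)) has_field_derivative ?f u) (at u within - {0})" if "u \<in> - {0}" for u
      by (rule has_field_derivative_at_within[OF deriv]) (use that in simp)
  qed auto
  ultimately have "2 * pi * \<i> * residue ?f 0 = 0"
    by (auto dest: has_contour_integral_unique)
  then show ?thesis by simp
qed

text \<open>
  In the coordinate with pole \<open>P\<close> the coefficient extends to an entire function, and the local parameter at \<open>P\<close>
  is the inverse of this coordinate.
\<close>

lemma Res_regular_away:
  assumes f: "f \<in> reg_forms (- {P})"
  shows "Res P f = 0"
proof -
  have germ: "regular_germ (form_in P f) w" for w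
    using affine_pt_neq[of P w, symmetric] by (intro regular_germ_form_in reg_forms_mono[OF f]) auto
  define H where "H = remove_sings (form_in P f)"
  have "H analytic_on {w}" for w
    using germ[of w] unfolding H_def regular_germ_iff_meromorphic
    by (intro remove_sings_regular_germ) auto
  then have H: "H holomorphic_on UNIV"
    using analytic_imp_holomorphic analytic_on_analytic_at by blast
  have mero: "form_at f P meromorphic_on {0}" using f by (auto simp: reg_forms_iff mero_form_def)
  have "eventually (\<lambda>u::complex. u \<noteq> 0) (at 0)" by (simp add: eventually_at_filter)
  with meromorphic_eventually_analytic[OF mero]
  have "eventually (\<lambda>u. form_at f P u = - H (1 / u) / u ^ 2) (at 0)"
  proof eventually_elim
    case (elim u)
    have "(form_at f P \<circ> (\<lambda>w. 1 / w)) analytic_on {1 / u}"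
      using elim by (intro analytic_on_compose analytic_intros) auto
    then have "(\<lambda>w. form_at f P (1 / w)) analytic_on {1 / u}" by (simp add: o_def)
    then have "(\<lambda>w. - form_at f P (1 / w) / w ^ 2) analytic_on {1 / u}"
      using elim by (intro analytic_intros) auto
    moreover have "eventually (\<lambda>w. - form_at f P (1 / w) / w ^ 2 = form_in P f w) (nhds (1 / u))"
      using elim by (intro eventually_mono[OF t1_space_nhds[of "1 / u" 0]])
        (auto simp: form_at_eq_form_in power_divide)
    ultimately have "form_in P f analytic_on {1 / u}"
      by (simp only: analytic_at_cong[OF _ refl])
    then show ?case using elim by (simp add: H_def form_at_eq_form_in)
  qed
  then have "Res P f = residue (\<lambda>u. - H (1 / u) / u ^ 2) 0"
    unfolding Res_def by (rule residue_cong) simp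
  then show ?thesis using residue_pullback_inverse[OF H] by simp
qed

lemma Res_cong: "eventually (\<lambda>z. f z = g z) cofinite \<Longrightarrow> Res P f = Res P g"
  unfolding Res_def by (intro residue_cong form_at_cong) auto

lemma Res_add: "f \<in> reg_forms A \<Longrightarrow> g \<in> reg_forms A \<Longrightarrow> Res P (\<lambda>z. f z + g z) = Res P f + Res P g"
  by (auto simp: Res_def form_at_add reg_forms_iff mero_form_def meromorphic_residue_add)

lemma Res_cmult: "f \<in> reg_forms A \<Longrightarrow> Res P (\<lambda>z. c * f z) = c * Res P f"
  by (auto simp: Res_def form_at_cmult reg_forms_iff mero_form_def meromorphic_residue_cmult)

lemma Res_regular: "f \<in> reg_forms {P} \<Longrightarrow> Res P f = 0"
  by (auto simp: Res_def reg_forms_iff intro: residue_regular_germ)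

interpretation right: residue_pairing "{P}" "- {P}" "Res P" for P
  by unfold_locales (auto intro: Res_cong Res_add Res_cmult Res_regular Res_regular_away)

interpretation left: residue_pairing "- {P}" "{P}" "\<lambda>f. - Res P f" for P
  by unfold_locales (auto simp: Res_add Res_cmult Res_regular Res_regular_away dest: Res_cong)

lemma Phi_right_commutator:
  assumes "mero_fun \<phi>" "mero_fun \<psi>"
  shows "Phi_right P \<phi> (Phi_right P \<psi> x) - Phi_right P \<psi> (Phi_right P \<phi> x) =
     Res P (fun_times_form \<phi> (dcoeff \<psi>)) *\<^sub>C x"
proof -
  have V: "right.V P = UNIV" by (simp add: right.V_def kforms_regular_on_empty)
  have "Phi_right P = right.Op P"
    unfolding Phi_right_def right.Op_def V right.coeff_def[abs_def] by (simp add: Let_def)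
  then show ?thesis
    using right.commutator[of \<phi> P \<psi> x] assms by (simp add: V symalg_on_UNIV reg_funs_iff)
qed

lemma Phi_left_commutator:
  assumes "mero_fun \<phi>" "mero_fun \<psi>"
  shows "Phi_left P \<phi> (Phi_left P \<psi> x) - Phi_left P \<psi> (Phi_left P \<phi> x) =
     (- Res P (fun_times_form \<phi> (dcoeff \<psi>))) *\<^sub>C x"
proof -
  have V: "left.V P = UNIV" by (simp add: left.V_def kforms_regular_on_empty)
  have "Phi_left P = left.Op P"
    unfolding Phi_left_def left.Op_def V left.coeff_def[abs_def] by (simp add: Let_def)
  then show ?thesis
    using left.commutator[of \<phi> P \<psi> x] assms by (simp add: V symalg_on_UNIV reg_funs_iff)
qed

section \<open>Integration along a smooth loop\<close>

lemma open_regular_germ: "open {z. regular_germ f z}"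
proof (subst open_subopen, intro ballI)
  fix z assume "z \<in> {z. regular_germ f z}"
  then obtain g where g: "g analytic_on {z}" "eventually (\<lambda>u. f u = g u) (at z)"
    unfolding regular_germ_def by blast
  obtain S where S: "open S" "z \<in> S" "g holomorphic_on S" using g(1) by (auto simp: analytic_at)
  obtain T where T: "open T" "z \<in> T" "\<And>u. u \<in> T \<Longrightarrow> u \<noteq> z \<Longrightarrow> f u = g u"
    using g(2) by (auto simp: eventually_at_topological)
  have "regular_germ f u" if "u \<in> S \<inter> T" for u
  proof (cases "u = z")
    case True
    then show ?thesis using g unfolding regular_germ_def by blast
  next
    case False
    have "g analytic_on {u}" using S(1,3) that by (auto simp: analytic_at)
    moreover have "eventually (\<lambda>w. f w = g w) (at u)"
      unfolding eventually_at_topological using T that False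
      by (intro exI[of _ "T - {z}"]) auto
    ultimately show ?thesis unfolding regular_germ_def by blast
  qed
  then show "\<exists>U. open U \<and> z \<in> U \<and> U \<subseteq> {z. regular_germ f z}"
    using S T by (intro exI[of _ "S \<inter> T"]) auto
qed

text \<open>
  Affine coordinates differ by Moebius transformations. The curve is smooth only in local coordinates that may
  change from point to point, and one coordinate valid along the whole curve is wanted.
\<close>

lemma coord_change:
  "\<exists>M M'. \<forall>p. p \<noteq> q \<and> p \<noteq> q' \<longrightarrow> coord q p = M (coord q' p) \<and>
     (M has_field_derivative M' (coord q' p)) (at (coord q' p)) \<and> isCont M' (coord q' p)"
proof (cases "q = q'")
  case True
  then show ?thesis by - (rule exI[of _ "\<lambda>w. w"], rule exI[of _ "\<lambda>w. 1"], simp)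
next
  case False
  show ?thesis
  proof (cases q)
    case None
    then obtain b where b: "q' = Some b" using False by (cases q') auto
    show ?thesis
    proof (rule exI[of _ "\<lambda>w. b + 1 / w"], rule exI[of _ "\<lambda>w. - 1 / w ^ 2"], intro allI impI)
      fix p assume p: "p \<noteq> q \<and> p \<noteq> q'"
      then obtain z where z: "p = Some z" "z \<noteq> b" using None b by (cases p) auto
      then have "coord q' p \<noteq> 0" using b by simp
      then show "coord q p = b + 1 / coord q' p \<and>
          ((\<lambda>w. b + 1 / w) has_field_derivative - 1 / (coord q' p) ^ 2) (at (coord q' p)) \<and>
          isCont (\<lambda>w. - 1 / w ^ 2) (coord q' p)"
        using z None b
        by (auto intro!: derivative_eq_intros continuous_intros simp: power2_eq_square)
    qed
  next
    case (Some a)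
    show ?thesis
    proof (cases q')
      case None
      show ?thesis
      proof (rule exI[of _ "\<lambda>w. 1 / (w - a)"], rule exI[of _ "\<lambda>w. - 1 / (w - a) ^ 2"], intro allI impI)
        fix p assume p: "p \<noteq> q \<and> p \<noteq> q'"
        then obtain z where z: "p = Some z" "z \<noteq> a" using None Some by (cases p) auto
        then show "coord q p = 1 / (coord q' p - a) \<and>
            ((\<lambda>w. 1 / (w - a)) has_field_derivative - 1 / (coord q' p - a) ^ 2) (at (coord q' p)) \<and>
            isCont (\<lambda>w. - 1 / (w - a) ^ 2) (coord q' p)"
          using None Some
          by (auto intro!: derivative_eq_intros continuous_intros simp: power2_eq_square)
      qed
    next
      case (Some b)
      with \<open>q = Some a\<close> False have ab: "a \<noteq> b" by auto
      show ?thesis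
      proof (rule exI[of _ "\<lambda>w. w / (1 + (b - a) * w)"], rule exI[of _ "\<lambda>w. 1 / (1 + (b - a) * w) ^ 2"], intro allI impI)
        fix p assume p: "p \<noteq> q \<and> p \<noteq> q'"
        have *: "1 + (b - a) * coord q' p \<noteq> 0 \<and> coord q p = coord q' p / (1 + (b - a) * coord q' p)"
        proof (cases p)
          case None
          then show ?thesis using \<open>q = Some a\<close> Some by simp
        next
          case (Some z)
          then have z: "z \<noteq> a" "z \<noteq> b" using p \<open>q = Some a\<close> \<open>q' = Some b\<close> by auto
          then have "1 + (b - a) * (1 / (z - b)) = (z - a) / (z - b)" by (simp add: field_simps)
          then show ?thesis using z Some \<open>q = Some a\<close> \<open>q' = Some b\<close> by simp
        qed
        moreover have "((\<lambda>w. w / (1 + (b - a) * w)) has_field_derivative 1 / (1 + (b - a) * w) ^ 2) (at w)"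
          if "1 + (b - a) * w \<noteq> 0" for w
          using that by (auto intro!: derivative_eq_intros simp: power2_eq_square)
        ultimately show "coord q p = coord q' p / (1 + (b - a) * coord q' p) \<and>
            ((\<lambda>w. w / (1 + (b - a) * w)) has_field_derivative 1 / (1 + (b - a) * coord q' p) ^ 2)
              (at (coord q' p)) \<and>
            isCont (\<lambda>w. 1 / (1 + (b - a) * w) ^ 2) (coord q' p)"
          by (auto intro!: continuous_intros)
      qed
    qed
  qed
qed

lemma smooth_regular_curve_C1:
  assumes \<gamma>: "smooth_regular_curve \<gamma>" and q: "\<And>t. \<gamma> t \<noteq> q"
  shows "(\<lambda>t. coord q (\<gamma> t)) C1_differentiable_on UNIV"
proof -
  let ?c = "\<lambda>t. coord q (\<gamma> t)"
  have "?c differentiable at t \<and> isCont (\<lambda>s. vector_derivative ?c (at s)) t" for t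
  proof -
    from \<gamma> obtain q' U where qU: "open U" "t \<in> U" "\<forall>s\<in>U. \<gamma> s \<noteq> q'"
      "smooth_on U (\<lambda>s. coord q' (\<gamma> s))"
      unfolding smooth_regular_curve_def by metis
    then have U: "open U" "t \<in> U" "\<And>s. s \<in> U \<Longrightarrow> \<gamma> s \<noteq> q'" "smooth_on U (\<lambda>s. coord q' (\<gamma> s))"
      by simp_all
    let ?e = "\<lambda>s. coord q' (\<gamma> s)"
    \<comment> \<open>Smoothness of orders \<open>0\<close> and \<open>1\<close>: the velocity is differentiable, hence continuous.\<close>
    have e: "?e differentiable_on U" "(\<lambda>s. vector_derivative ?e (at s)) differentiable_on U"
      using U(4)[unfolded smooth_on_def, THEN spec, of 0] U(4)[unfolded smooth_on_def, THEN spec, of 1]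
      by simp_all
    have eD: "(?e has_vector_derivative vector_derivative ?e (at s)) (at s)" if "s \<in> U" for s
      using e(1) U(1) that
      by (metis at_within_open differentiable_on_def vector_derivative_works)
    have econt: "isCont ?e t" using eD[OF U(2)] has_vector_derivative_continuous by blast
    have e'cont: "isCont (\<lambda>s. vector_derivative ?e (at s)) t"
      using e(2) U(1,2) by (metis at_within_open differentiable_imp_continuous_within differentiable_on_def)
    obtain M M' where M: "\<And>p. p \<noteq> q \<Longrightarrow> p \<noteq> q' \<Longrightarrow> coord q p = M (coord q' p)"
      "\<And>p. p \<noteq> q \<Longrightarrow> p \<noteq> q' \<Longrightarrow> (M has_field_derivative M' (coord q' p)) (at (coord q' p))"
      "\<And>p. p \<noteq> q \<Longrightarrow> p \<noteq> q' \<Longrightarrow> isCont M' (coord q' p)"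
      using coord_change[of q q'] by metis
    have cD: "(?c has_vector_derivative vector_derivative ?e (at s) * M' (?e s)) (at s)" if "s \<in> U" for s
    proof (rule has_vector_derivative_transform_within_open[OF _ U(1) that])
      show "(M \<circ> ?e has_vector_derivative vector_derivative ?e (at s) * M' (?e s)) (at s)"
        using q U(3) that by (intro field_vector_diff_chain_at eD M(2))
      show "(M \<circ> ?e) y = ?c y" if "y \<in> U" for y
        using M(1)[of "\<gamma> y"] q U(3)[OF that] by simp
    qed
    have "isCont (\<lambda>s. M' (?e s)) t"
      using isCont_o2[OF econt, of M'] M(3)[of "\<gamma> t"] q U(2,3) by auto
    then have "isCont (\<lambda>s. vector_derivative ?e (at s) * M' (?e s)) t"
      by (intro continuous_intros e'cont)
    moreover have "eventually (\<lambda>s. vector_derivative ?c (at s) = vector_derivative ?e (at s) * M' (?e s)) (nhds t)"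
      using eventually_nhds_in_open[OF U(1,2)] by eventually_elim (rule vector_derivative_at[OF cD])
    ultimately have "isCont (\<lambda>s. vector_derivative ?c (at s)) t"
      by (simp add: isCont_cong)
    then show ?thesis using cD[OF U(2)] differentiableI_vector by blast
  qed
  then show ?thesis by (simp add: C1_differentiable_on_eq continuous_at_imp_continuous_on)
qed

text \<open>
  A smooth simple closed curve on the projective line with image \<open>F\<close>. It may pass through infinity, so the
  integrals of forms are transferred to a coordinate whose pole lies off the curve.
\<close>

locale smooth_loop =
  fixes \<gamma> :: "real \<Rightarrow> cp1" and F :: "cp1 set"
  assumes smooth: "smooth_regular_curve \<gamma>"
    and period: "\<And>t. \<gamma> (t + 1) = \<gamma> t"
    and inj: "inj_on \<gamma> {0..<1}"
    and image: "\<gamma> ` {0..1} = F"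
begin

lemma in_F: "\<gamma> t \<in> F"
proof -
  interpret periodic_fun_simple' \<gamma> by unfold_locales (rule period)
  have "\<gamma> t = \<gamma> (frac t)"
    using plus_of_int[of "frac t" "\<lfloor>t\<rfloor>"] by (simp add: frac_def)
  moreover have "frac t \<in> {0..1}" using frac_lt_1[of t] by simp
  ultimately show ?thesis using image by auto
qed

lemma finite_parameters:
  assumes "finite E"
  shows "finite {t \<in> {0..1}. \<gamma> t \<in> E}"
proof -
  have "finite (\<gamma> -` E \<inter> {0..<1})" by (rule finite_vimage_IntI[OF assms inj])
  moreover have "{t \<in> {0..1}. \<gamma> t \<in> E} \<subseteq> insert 1 (\<gamma> -` E \<inter> {0..<1})" by auto
  ultimately show ?thesis by (meson finite.insertI finite_subset)
qed

abbreviation affine_path :: "cp1 \<Rightarrow> real \<Rightarrow> complex" where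
  "affine_path q \<equiv> \<lambda>t. coord q (\<gamma> t)"

lemma path_image_affine_path: "path_image (affine_path q) = coord q ` F"
  by (auto simp: path_image_def simp flip: image)

context
  fixes q assumes q: "q \<notin> F"
begin

lemma neq: "\<gamma> t \<noteq> q" using in_F q by metis

lemma C1_affine_path: "affine_path q C1_differentiable_on UNIV"
  by (rule smooth_regular_curve_C1[OF smooth neq])

lemma affine_path_derivative: "(affine_path q has_vector_derivative vector_derivative (affine_path q) (at t)) (at t)"
  using C1_affine_path by (simp add: C1_differentiable_on_eq vector_derivative_works)

lemma valid_affine_path: "valid_path (affine_path q)"
  unfolding valid_path_def
  by (intro C1_differentiable_imp_piecewise C1_differentiable_on_subset[OF C1_affine_path]) auto

lemma closed_affine_path: "pathfinish (affine_path q) = pathstart (affine_path q)"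
  using period[of 0] by (simp add: pathfinish_def pathstart_def)

lemma simple_affine_path: "simple_path (affine_path q)"
proof -
  have "loop_free (affine_path q)"
    unfolding loop_free_def
  proof (intro ballI impI)
    fix x y :: real assume xy: "x \<in> {0..1}" "y \<in> {0..1}" "affine_path q x = affine_path q y"
    then have eq: "\<gamma> x = \<gamma> y" using coord_inj neq by blast
    have "\<gamma> 1 = \<gamma> 0" using period[of 0] by simp
    then have "x = y" if "x \<noteq> 1" "y \<noteq> 1"
      using inj_onD[OF inj eq] xy that by auto
    moreover have "x = 0 \<or> x = 1" if "y = 1"
      using inj_onD[OF inj, of x 0] eq xy \<open>\<gamma> 1 = \<gamma> 0\<close> that by fastforce
    moreover have "y = 0 \<or> y = 1" if "x = 1"
      using inj_onD[OF inj, of y 0] eq xy \<open>\<gamma> 1 = \<gamma> 0\<close> that by fastforce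
    ultimately show "x = y \<or> x = 0 \<and> y = 1 \<or> x = 1 \<and> y = 0" by blast
  qed
  then show ?thesis using valid_path_imp_path[OF valid_affine_path] by (simp add: simple_path_def)
qed

lemma affine_pt_in_F: "w \<in> path_image (affine_path q) \<Longrightarrow> affine_pt q w \<in> F"
  using q by (metis affine_pt_coord imageE path_image_affine_path)

text \<open>
  The standard coordinate of the curve may fail to be continuous where the curve meets infinity. As the curve is
  simple, this concerns at most two parameters in \<open>[0, 1]\<close>; elsewhere the integrands agree by the chain
  rule.
\<close>

lemma has_form_integral_iff:
  "(f has_contour_integral i) (affine_path None) \<longleftrightarrow> (form_in q f has_contour_integral i) (affine_path q)"
proof (cases q)
  case None
  have "form_in None f = f" by (rule ext) simp
  then show ?thesis using None by simp
next
  case (Some b)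
  have fin: "finite {t \<in> {0..1}. \<gamma> t \<in> {None}}" by (rule finite_parameters) simp
  show ?thesis
    unfolding has_contour_integral
  proof (rule has_integral_spike_finite_eq[OF fin])
    fix t :: real assume "t \<in> {0..1} - {t \<in> {0..1}. \<gamma> t \<in> {None}}"
    then have t: "\<gamma> t \<noteq> None" by auto
    have nz: "affine_path q s \<noteq> 0 \<longleftrightarrow> \<gamma> s \<noteq> None" for s
      using neq[of s] Some by (cases "\<gamma> s") auto
    have aff: "affine_path None s = b + 1 / affine_path q s" if "affine_path q s \<noteq> 0" for s
      using neq[of s] nz[of s] that Some by (cases "\<gamma> s") auto
    have "isCont (affine_path q) t" using affine_path_derivative has_vector_derivative_continuous by blast
    then have "(affine_path q \<longlongrightarrow> affine_path q t) (nhds t)" using tendsto_at_iff_tendsto_nhds[of "affine_path q" t] by (simp add: isCont_def)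
    then have op: "eventually (\<lambda>s. affine_path q s \<noteq> 0) (nhds t)"
      by (rule tendsto_imp_eventually_ne) (use nz[of t] t in simp)
    have "((\<lambda>w. b + 1 / w) has_field_derivative - 1 / (affine_path q t) ^ 2) (at (affine_path q t))"
      using nz[of t] t by (auto intro!: derivative_eq_intros simp: power2_eq_square)
    from field_vector_diff_chain_at[OF affine_path_derivative this]
    have deriv: "((\<lambda>w. b + 1 / w) \<circ> affine_path q has_vector_derivative
      vector_derivative (affine_path q) (at t) * (- 1 / (affine_path q t) ^ 2)) (at t)" .
    obtain S where S: "open S" "t \<in> S" "\<And>s. s \<in> S \<Longrightarrow> affine_path q s \<noteq> 0"
      using op unfolding eventually_nhds by blast
    have "(affine_path None has_vector_derivative
      vector_derivative (affine_path q) (at t) * (- 1 / (affine_path q t) ^ 2)) (at t)"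
      by (rule has_vector_derivative_transform_within_open[OF deriv S(1,2)]) (use aff S(3) in auto)
    then have "vector_derivative (affine_path None) (at t) = vector_derivative (affine_path q) (at t) * (- 1 / (affine_path q t) ^ 2)"
      by (rule vector_derivative_at)
    then show "form_in q f (affine_path q t) * vector_derivative (affine_path q) (at t) =
        f (affine_path None t) * vector_derivative (affine_path None) (at t)"
      using Some aff[of t] nz[of t] t by simp
  qed
qed

lemma form_integral_eq: "form_integral \<gamma> f = contour_integral (affine_path q) (form_in q f)"
  unfolding form_integral_def contour_integral_def contour_integrable_on_def
  by (simp add: has_form_integral_iff)

lemma has_contour_integral_spike:
  assumes "finite {w \<in> path_image (affine_path q). f w \<noteq> g w}"
  shows "(f has_contour_integral i) (affine_path q) \<longleftrightarrow> (g has_contour_integral i) (affine_path q)"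
proof -
  have "finite (affine_pt q ` {w \<in> path_image (affine_path q). f w \<noteq> g w})" using assms by simp
  then have fin: "finite {t \<in> {0..1}. \<gamma> t \<in> affine_pt q ` {w \<in> path_image (affine_path q). f w \<noteq> g w}}"
    by (rule finite_parameters)
  show ?thesis
    unfolding has_contour_integral
  proof (rule has_integral_spike_finite_eq[OF fin])
    fix t :: real
    assume t: "t \<in> {0..1} - {t \<in> {0..1}. \<gamma> t \<in> affine_pt q ` {w \<in> path_image (affine_path q). f w \<noteq> g w}}"
    have "f (affine_path q t) = g (affine_path q t)"
    proof (rule ccontr)
      assume "f (affine_path q t) \<noteq> g (affine_path q t)"
      moreover have "affine_path q t \<in> path_image (affine_path q)" using t by (auto simp: path_image_def)
      moreover have "affine_pt q (affine_path q t) = \<gamma> t" using neq by simp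
      ultimately show False using t by (metis (mono_tags, lifting) DiffD1 DiffD2 imageI mem_Collect_eq)
    qed
    then show "g (affine_path q t) * vector_derivative (affine_path q) (at t) = f (affine_path q t) * vector_derivative (affine_path q) (at t)"
      by simp
  qed
qed

text \<open>
  Along the compact curve a regular form differs from its holomorphic extension at finitely many points only, and
  a simple curve passes through these for finitely many parameters.
\<close>

lemma remove_sings_on_path:
  assumes f: "f \<in> reg_forms F"
  shows "remove_sings (form_in q f) analytic_on path_image (affine_path q)"
    and "(form_in q f has_contour_integral i) (affine_path q) \<longleftrightarrow>
      (remove_sings (form_in q f) has_contour_integral i) (affine_path q)"
proof -
  let ?H = "remove_sings (form_in q f)"
  have reg: "regular_germ (form_in q f) w" if "w \<in> path_image (affine_path q)" for w
  proof (rule regular_germ_form_in, rule reg_forms_mono[OF f])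
    show "{affine_pt q w} \<subseteq> F" using affine_pt_in_F[OF that] by simp
  qed
  have H: "?H analytic_on {w}" "eventually (\<lambda>u. form_in q f u = ?H u) (at w)"
    if "w \<in> path_image (affine_path q)" for w
    using reg[OF that] remove_sings_regular_germ unfolding regular_germ_iff_meromorphic by blast+
  then show "?H analytic_on path_image (affine_path q)" using analytic_on_analytic_at by blast
  have "compact (path_image (affine_path q))" using valid_affine_path by (simp add: compact_valid_path_image)
  then have "finite (path_image (affine_path q) \<inter> {w. form_in q f w \<noteq> ?H w})"
    using H(2) by (intro finite_not_islimpt_in_compact) (auto simp: islimpt_iff_eventually)
  then show "(form_in q f has_contour_integral i) (affine_path q) \<longleftrightarrow> (?H has_contour_integral i) (affine_path q)"
    by (intro has_contour_integral_spike) (simp add: Int_def)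
qed

lemma form_integrable:
  assumes f: "f \<in> reg_forms F"
  shows "f contour_integrable_on affine_path None"
proof -
  obtain S where S: "open S" "path_image (affine_path q) \<subseteq> S" "remove_sings (form_in q f) holomorphic_on S"
    using remove_sings_on_path(1)[OF f] unfolding analytic_on_holomorphic by blast
  then have "remove_sings (form_in q f) contour_integrable_on affine_path q"
    by (intro contour_integrable_holomorphic_simple valid_affine_path)
  then show ?thesis
    unfolding contour_integrable_on_def has_form_integral_iff remove_sings_on_path(2)[OF f] .
qed

text \<open>
  The hypothesis on winding numbers concerns only the points at which the form may have a pole, so the homology
  form of Cauchy's theorem applies to the set of regular points.
\<close>

lemma Cauchy_theorem_forms:
  assumes f: "f \<in> reg_forms (A \<union> F)"
    and zero: "\<And>p. p \<notin> A \<union> F \<Longrightarrow> p \<noteq> q \<Longrightarrow> winding_number (affine_path q) (coord q p) = 0"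
  shows "form_integral \<gamma> f = 0"
proof -
  have fF: "f \<in> reg_forms F" by (rule reg_forms_mono[OF f]) auto
  let ?S = "{w. regular_germ (form_in q f) w}"
  have reg: "w \<in> ?S" if "affine_pt q w \<in> A \<union> F" for w
    using regular_germ_form_in[OF reg_forms_mono[OF f, of "{affine_pt q w}"]] that by auto
  have "(remove_sings (form_in q f) has_contour_integral 0) (affine_path q)"
  proof (rule Cauchy_theorem_global[OF open_regular_germ _ valid_affine_path closed_affine_path])
    have "remove_sings (form_in q f) analytic_on {w}" if "w \<in> ?S" for w
      using that remove_sings_regular_germ unfolding regular_germ_iff_meromorphic by blast
    then show "remove_sings (form_in q f) holomorphic_on ?S"
      using analytic_imp_holomorphic analytic_on_analytic_at by blast
    show "path_image (affine_path q) \<subseteq> ?S"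
    proof
      fix w assume "w \<in> path_image (affine_path q)"
      then have "affine_pt q w \<in> F" by (rule affine_pt_in_F)
      then show "w \<in> ?S" using reg by blast
    qed
    show "winding_number (affine_path q) w = 0" if "w \<notin> ?S" for w
      using zero[of "affine_pt q w"] reg[of w] that by auto
  qed
  then have "(form_in q f has_contour_integral 0) (affine_path q)"
    using remove_sings_on_path(2)[OF fF] by blast
  then show ?thesis using form_integral_eq contour_integral_unique by metis
qed

end

end

section \<open>Boundaries of discs\<close>

text \<open>
  The difference \<open>polar_form p - polar_form q\<close> is the logarithmic differential of a function with a simple zero
  at \<open>p\<close> and a simple pole at \<open>q\<close>; one term is absent if the point is infinity.
\<close>

definition polar_form :: "cp1 \<Rightarrow> complex \<Rightarrow> complex" where
  "polar_form p z = (case p of None \<Rightarrow> 0 | Some a \<Rightarrow> 1 / (z - a))"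

lemma form_in_polar_form:
  assumes "p \<noteq> q" "w \<noteq> 0" "w \<noteq> coord q p"
  shows "form_in q (\<lambda>z. polar_form p z - polar_form q z) w = 1 / (w - coord q p)"
proof (cases q)
  case None
  then show ?thesis using assms(1) by (cases p) (auto simp: polar_form_def)
next
  case (Some b)
  show ?thesis
  proof (cases p)
    case None
    then show ?thesis using Some assms by (simp add: polar_form_def power2_eq_square)
  next
    case (Some a)
    then have ab: "a \<noteq> b" using assms(1) \<open>q = Some b\<close> by auto
    have w: "w * (a - b) \<noteq> 1" using assms(3) Some \<open>q = Some b\<close> ab by (auto simp: field_simps)
    have "b + 1 / w - a \<noteq> 0" using w assms(2) by (auto simp: field_simps)
    then have "- (1 / (b + 1 / w - a) - w) / w ^ 2 = 1 / (w - 1 / (a - b))"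
      using ab w assms(2,3) Some \<open>q = Some b\<close> by (simp add: divide_simps) (simp add: algebra_simps power2_eq_square)
    then show ?thesis using Some \<open>q = Some b\<close> by (simp add: polar_form_def)
  qed
qed

context smooth_loop
begin

text \<open>
  A winding number in the coordinate with pole \<open>q\<close> is an integral of a form that does not refer to this
  coordinate.
\<close>

lemma has_integral_polar_form:
  assumes "q \<notin> F" "p \<notin> F" "p \<noteq> q"
  shows "((\<lambda>z. polar_form p z - polar_form q z) has_contour_integral
    2 * pi * \<i> * winding_number (affine_path q) (coord q p)) (affine_path None)"
  unfolding has_form_integral_iff[OF assms(1)]
proof (subst has_contour_integral_spike[OF assms(1)])
  show "finite {w \<in> path_image (affine_path q). form_in q (\<lambda>z. polar_form p z - polar_form q z) w \<noteq> 1 / (w - coord q p)}"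
    by (rule finite_subset[of _ "{0, coord q p}"]) (use form_in_polar_form[OF assms(3)] in auto)
  have "coord q p \<notin> path_image (affine_path q)"
    using affine_pt_in_F[OF assms(1), of "coord q p"] assms by auto
  then show "((\<lambda>w. 1 / (w - coord q p)) has_contour_integral
      2 * pi * \<i> * winding_number (affine_path q) (coord q p)) (affine_path q)"
    by (intro has_contour_integral_winding_number valid_affine_path assms)
qed

text \<open>
  The logarithmic differentials satisfy \<open>(p) - (q') = ((p) - (q)) - ((q') - (q))\<close>, and the integral is
  additive.
\<close>

lemma winding_number_change_pole:
  assumes "q \<notin> F" "q' \<notin> F" "p \<notin> F" "p \<noteq> q" "p \<noteq> q'" "q \<noteq> q'"
  shows "winding_number (affine_path q') (coord q' p) =
    winding_number (affine_path q) (coord q p) - winding_number (affine_path q) (coord q q')"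
proof -
  let ?n = "\<lambda>q p. winding_number (affine_path q) (coord q p)"
  have "((\<lambda>z. (polar_form p z - polar_form q z) - (polar_form q' z - polar_form q z)) has_contour_integral
      2 * pi * \<i> * ?n q p - 2 * pi * \<i> * ?n q q') (affine_path None)"
    by (intro has_contour_integral_diff has_integral_polar_form) (use assms in auto)
  moreover have "((\<lambda>z. polar_form p z - polar_form q' z) has_contour_integral 2 * pi * \<i> * ?n q' p) (affine_path None)"
    by (intro has_integral_polar_form assms)
  ultimately have "2 * pi * \<i> * ?n q' p = 2 * pi * \<i> * ?n q p - 2 * pi * \<i> * ?n q q'"
    by (simp add: has_contour_integral_unique)
  then have "2 * pi * \<i> * ?n q' p = 2 * pi * \<i> * (?n q p - ?n q q')"
    by (simp add: right_diff_distrib)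
  then show ?thesis by (subst (asm) mult_left_cancel) simp_all
qed

end

lemma topspace_cp1: "topspace cp1_topology = UNIV"
  by (simp add: cp1_topology_def UNIV_option_conv)

text \<open>
  Affine charts are continuous for the topology of the one-point compactification. The delicate point is \<open>w = 0\<close>
  in a chart with finite pole \<open>b\<close>: it represents infinity, whose neighbourhoods are complements of compact sets.
\<close>

lemma open_affine_chart:
  assumes "openin cp1_topology U"
  shows "open {w. affine_pt q w \<in> U}"
proof -
  have fin: "open {z. Some z \<in> U}"
    using assms unfolding cp1_topology_def openin_Alexandroff_compactification
    by (auto simp: image_iff open_Compl simp flip: Compl_eq)
  show ?thesis
  proof (cases q)
    case None
    then show ?thesis using fin by simp
  next
    case (Some b)
    have "open ((UNIV - {0}) \<inter> (\<lambda>w. b + 1 / w) -` {z. Some z \<in> U})"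
      by (rule continuous_open_preimage[OF _ _ fin]) (auto intro!: continuous_intros)
    then have op: "open {w. w \<noteq> 0 \<and> Some (b + 1 / w) \<in> U}"
      by (rule back_subst[of "open"]) auto
    show ?thesis
    proof (cases "None \<in> U")
      case False
      then have "{w. affine_pt q w \<in> U} = {w. w \<noteq> 0 \<and> Some (b + 1 / w) \<in> U}"
        using Some by auto
      then show ?thesis using op by simp
    next
      case True
      then obtain C where C: "compact C" "U = insert None (Some ` (- C))"
        using assms unfolding cp1_topology_def openin_Alexandroff_compactification
        by (auto simp: Compl_eq_Diff_UNIV)
      obtain r where r: "r > 0" "\<And>z. z \<in> C \<Longrightarrow> norm z \<le> r"
        using compact_imp_bounded[OF C(1)] by (auto simp: bounded_pos)
      \<comment> \<open>For \<open>norm w < e\<close> the point \<open>b + 1 / w\<close> has modulus greater than \<open>r\<close>, so it avoids \<open>C\<close>.\<close>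
      define e where "e = 1 / (r + norm b + 1)"
      have pos: "r + norm b + 1 > 0" using r(1) by (simp add: add_pos_nonneg)
      let ?W = "{w. affine_pt q w \<in> U}"
      have "w \<in> ?W" if "w \<in> ball 0 e" for w
      proof (cases "w = 0")
        case True
        then show ?thesis using Some \<open>None \<in> U\<close> by simp
      next
        case False
        have "norm w * (r + norm b + 1) < 1" using that pos by (simp add: e_def field_simps)
        then have "norm (1 / w) > r + norm b + 1"
          using False by (simp add: norm_divide field_simps)
        then have "norm (b + 1 / w) > r"
          using norm_triangle_ineq4[of "b + 1 / w" b] by simp
        then have "b + 1 / w \<notin> C" using r(2)[of "b + 1 / w"] by auto
        then show ?thesis using Some False C(2) by simp
      qed
      then have "ball 0 e \<subseteq> ?W" by (rule subsetI)
      moreover have "?W - {0} = {w. w \<noteq> 0 \<and> Some (b + 1 / w) \<in> U}"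
        using Some by auto
      moreover have "0 \<in> ball (0 :: complex) e" using pos by (simp add: e_def)
      ultimately have "?W = (?W - {0}) \<union> ball 0 e" "open (?W - {0})"
        using op by auto
      then show ?thesis by (metis open_Un open_ball)
    qed
  qed
qed

locale oriented_disc =
  fixes D :: "cp1 set" and \<gamma> :: "real \<Rightarrow> cp1"
  assumes disc: "disc D" and oriented: "oriented_boundary D \<gamma>"
begin

definition F :: "cp1 set" where "F = cp1_topology frontier_of D"

lemma open_D: "openin cp1_topology D"
  using disc by (simp add: disc_def)

lemma open_opposite: "openin cp1_topology (opposite_disc D)"
  using closedin_closure_of[of cp1_topology D]
  by (simp add: opposite_disc_def closedin_def topspace_cp1 Compl_eq_Diff_UNIV)

lemma partition:
  "D \<inter> F = {}" "opposite_disc D \<inter> F = {}" "D \<inter> opposite_disc D = {}"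
  "D \<union> F \<union> opposite_disc D = UNIV"
proof -
  have F: "F = cp1_topology closure_of D - D"
    using open_D by (simp add: F_def frontier_of_def interior_of_openin)
  have "D \<subseteq> cp1_topology closure_of D"
    by (rule closure_of_subset) (simp add: topspace_cp1)
  then show "D \<inter> F = {}" "opposite_disc D \<inter> F = {}" "D \<inter> opposite_disc D = {}"
    "D \<union> F \<union> opposite_disc D = UNIV"
    by (auto simp: F opposite_disc_def)
qed

sublocale smooth_loop \<gamma> F
  using oriented by unfold_locales
    (auto simp: oriented_boundary_def smooth_boundary_param_def F_def)

lemma D_two_points: "\<exists>p\<in>D. p \<noteq> q"
proof -
  \<comment> \<open>A biholomorphic image of the unit disc has more than one point.\<close>
  obtain h where h: "bij_betw h (ball (0::complex) 1) D"
    using disc unfolding disc_def biholomorphic_to_unit_disc_def by blast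
  have "h 0 \<noteq> h (1/2)"
    using inj_onD[OF bij_betw_imp_inj_on[OF h], of 0 "1/2"] by auto
  moreover have "h 0 \<in> D" "h (1/2) \<in> D" using bij_betwE[OF h] by auto
  ultimately show ?thesis by metis
qed

text \<open>
  The two sides \<open>D\<close> and \<open>D'\<close> are open and disjoint in the chart and fill the complement of the curve. Since
  \<open>D\<close> has winding number \<open>1\<close>, it lies inside the curve; the inside is connected by the Jordan curve
  theorem, so no point of \<open>D'\<close> is inside, and outside the winding number is zero.
\<close>

lemma winding_number_opposite:
  assumes q: "q \<in> opposite_disc D" and D: "\<And>p. p \<in> D \<Longrightarrow> winding_number (affine_path q) (coord q p) = 1"
    and p: "p \<in> opposite_disc D" "p \<noteq> q"
  shows "winding_number (affine_path q) (coord q p) = 0"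
proof -
  have qF: "q \<notin> F" using q partition by auto
  note simple = simple_affine_path[OF qF] and closed = closed_affine_path[OF qF]
  let ?K = "path_image (affine_path q)"
  let ?Di = "{w. affine_pt q w \<in> D}" and ?De = "{w. affine_pt q w \<in> opposite_disc D}"
  have K: "w \<in> ?K \<longleftrightarrow> affine_pt q w \<in> F" for w
  proof
    assume "affine_pt q w \<in> F"
    then have "coord q (affine_pt q w) \<in> ?K" unfolding path_image_affine_path by (rule imageI)
    then show "w \<in> ?K" by simp
  qed (rule affine_pt_in_F[OF qF])
  have Jordan: "connected (inside ?K)" "inside ?K \<union> outside ?K = - ?K"
    using Jordan_inside_outside[OF simple closed] by auto
  have zero: "winding_number (affine_path q) w = 0" if "w \<in> outside ?K" for w
    using winding_number_zero_in_outside[OF simple_path_imp_path[OF simple] closed that] .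
  have Di: "?Di \<subseteq> inside ?K"
  proof
    fix w assume w: "w \<in> ?Di"
    then have "winding_number (affine_path q) w = 1" using D[of "affine_pt q w"] by simp
    then have "w \<notin> outside ?K" using zero[of w] by auto
    moreover have "w \<notin> ?K" using K[of w] w partition(1) by auto
    ultimately show "w \<in> inside ?K" using Jordan(2) by blast
  qed
  have "?Di \<inter> inside ?K = {} \<or> ?De \<inter> inside ?K = {}"
  proof (rule connectedD[OF Jordan(1)])
    show "open ?Di" "open ?De"
      by (intro open_affine_chart open_D open_opposite)+
    show "?Di \<inter> ?De \<inter> inside ?K = {}" using partition(3) by blast
    show "inside ?K \<subseteq> ?Di \<union> ?De"
    proof
      fix w assume "w \<in> inside ?K"
      then have "affine_pt q w \<notin> F" using Jordan(2) K[of w] by blast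
      then show "w \<in> ?Di \<union> ?De" using partition(4) by auto
    qed
  qed
  moreover have "?Di \<inter> inside ?K \<noteq> {}"
  proof -
    obtain p' where "p' \<in> D" "p' \<noteq> q" using D_two_points[of q] by auto
    then have p': "coord q p' \<in> ?Di" by simp
    from p' subsetD[OF Di p'] have "coord q p' \<in> ?Di \<inter> inside ?K" by (rule IntI)
    then show ?thesis by (rule ex_in_conv[THEN iffD1, OF exI])
  qed
  ultimately have "?De \<inter> inside ?K = {}" by simp
  moreover have "coord q p \<in> ?De" using p by simp
  moreover have "coord q p \<notin> ?K" using K[of "coord q p"] p partition(2) by auto
  ultimately have "coord q p \<in> outside ?K" using Jordan(2) by blast
  then show ?thesis by (rule zero)
qed

text \<open>
  For a form regular on the closure of \<open>D\<close> the pole of the coordinate is taken in \<open>D'\<close>, where the winding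
  numbers vanish. For a form regular on the closure of \<open>D'\<close> it is taken in \<open>D\<close>; there the winding numbers are
  differences \<open>1 - 1\<close>.
\<close>

lemma boundary_integral_zero:
  shows "f \<in> reg_forms (opposite_disc D \<union> F) \<Longrightarrow> form_integral \<gamma> f = 0"
    and "f \<in> reg_forms (D \<union> F) \<Longrightarrow> form_integral \<gamma> f = 0"
proof -
  obtain q where q: "q \<in> opposite_disc D" and one: "\<And>p. p \<in> D \<Longrightarrow> winding_number (affine_path q) (coord q p) = 1"
    using oriented unfolding oriented_boundary_def by blast
  have qF: "q \<notin> F" using q partition by auto
  show "form_integral \<gamma> f = 0" if "f \<in> reg_forms (D \<union> F)"
  proof (rule Cauchy_theorem_forms[OF qF that])
    fix p assume p: "p \<notin> D \<union> F" "p \<noteq> q"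
    then have "p \<in> opposite_disc D" using partition(4) by auto
    then show "winding_number (affine_path q) (coord q p) = 0"
      using winding_number_opposite[OF q one] p by blast
  qed
  show "form_integral \<gamma> f = 0" if "f \<in> reg_forms (opposite_disc D \<union> F)"
  proof -
    obtain q' where q': "q' \<in> D" using D_two_points by blast
    then have q'F: "q' \<notin> F" "q \<noteq> q'" using partition q by auto
    show ?thesis
    proof (rule Cauchy_theorem_forms[OF q'F(1) that])
      fix p assume p: "p \<notin> opposite_disc D \<union> F" "p \<noteq> q'"
      then have "p \<in> D" "p \<noteq> q" using partition(4) q by auto
      then show "winding_number (affine_path q') (coord q' p) = 0"
        using winding_number_change_pole[OF qF q'F(1), of p] p q'F one q' by simp
    qed
  qed
qed

lemma form_integral_cong:
  assumes "eventually (\<lambda>z. f z = g z) cofinite"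
  shows "form_integral \<gamma> f = form_integral \<gamma> g"
proof -
  have fin: "finite {t \<in> {0..1}. \<gamma> t \<in> insert None (Some ` {z. f z \<noteq> g z})}"
    using assms by (intro finite_parameters) (simp add: eventually_cofinite)
  have "(f has_contour_integral i) (affine_path None) \<longleftrightarrow> (g has_contour_integral i) (affine_path None)" for i
    unfolding has_contour_integral
    by (rule has_integral_spike_finite_eq[OF fin]) (auto simp: image_iff split: option.splits, metis coord.simps(1) not_Some_eq)
  then show ?thesis
    unfolding form_integral_def contour_integral_def contour_integrable_on_def by simp
qed

lemma ex_pole: "\<exists>q. q \<notin> F"
  using D_two_points partition by blast

sublocale boundary: residue_pairing "opposite_disc D \<union> F" "D \<union> F"
  "\<lambda>f. - (1 / (2 * pi * \<i>) * form_integral \<gamma> f)"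
proof -
  have int: "(opposite_disc D \<union> F) \<inter> (D \<union> F) = F" using partition by auto
  obtain q where q: "q \<notin> F" using ex_pole by blast
  show "residue_pairing (opposite_disc D \<union> F) (D \<union> F) (\<lambda>f. - (1 / (2 * pi * \<i>) * form_integral \<gamma> f))"
  proof (unfold_locales, unfold int)
    show "(opposite_disc D \<union> F) \<union> (D \<union> F) = UNIV" using partition(4) by auto
  next
    fix f g :: "complex \<Rightarrow> complex" assume "eventually (\<lambda>z. f z = g z) cofinite"
    then show "- (1 / (2 * pi * \<i>) * form_integral \<gamma> f) = - (1 / (2 * pi * \<i>) * form_integral \<gamma> g)"
      by (simp add: form_integral_cong[of f g])
  next
    fix f g assume fg: "f \<in> reg_forms F" "g \<in> reg_forms F"
    have "form_integral \<gamma> (\<lambda>z. f z + g z) = form_integral \<gamma> f + form_integral \<gamma> g"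
      unfolding form_integral_def by (intro contour_integral_add form_integrable[OF q] fg)
    then show "- (1 / (2 * pi * \<i>) * form_integral \<gamma> (\<lambda>z. f z + g z)) =
        - (1 / (2 * pi * \<i>) * form_integral \<gamma> f) + - (1 / (2 * pi * \<i>) * form_integral \<gamma> g)"
      by (simp add: distrib_left)
  next
    fix f and c :: complex assume "f \<in> reg_forms F"
    then have "form_integral \<gamma> (\<lambda>z. c * f z) = c * form_integral \<gamma> f"
      unfolding form_integral_def by (intro contour_integral_lmul form_integrable[OF q])
    then show "- (1 / (2 * pi * \<i>) * form_integral \<gamma> (\<lambda>z. c * f z)) =
        c * - (1 / (2 * pi * \<i>) * form_integral \<gamma> f)"
      by simp
  qed (simp_all add: boundary_integral_zero)
qed

lemma Phi_disc_commutator: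
  assumes "mero_fun \<phi>" "mero_fun \<psi>" "fun_regular_on \<phi> F" "fun_regular_on \<psi> F" "x \<in> W_boundary D"
  shows "Phi_disc D \<gamma> \<phi> (Phi_disc D \<gamma> \<psi> x) - Phi_disc D \<gamma> \<psi> (Phi_disc D \<gamma> \<phi> x) =
    (- (1 / (2 * pi * \<i>) * form_integral \<gamma> (fun_times_form \<phi> (dcoeff \<psi>)))) *\<^sub>C x"
proof -
  have int: "(opposite_disc D \<union> F) \<inter> (D \<union> F) = F" using partition by auto
  have V: "boundary.V = kforms_regular_on F" by (simp add: boundary.V_def int)
  have Phi: "Phi_disc D \<gamma> = boundary.Op"
    unfolding Phi_disc_def boundary.Op_def boundary.coeff_def[abs_def] boundary_coeff_def[abs_def] V
    by (simp add: Let_def F_def)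
  have "\<phi> \<in> reg_funs F" "\<psi> \<in> reg_funs F" "x \<in> symalg_on (kforms_regular_on F)"
    using assms by (simp_all add: reg_funs_def W_boundary_def F_def)
  then show ?thesis
    using boundary.commutator[of \<phi> \<psi> x] unfolding Phi V int by blast
qed

end

section \<open>The commutation relations\<close>

theorem proposition5p9:
  fixes \<phi> \<psi> :: "cp1 \<Rightarrow> complex"
  assumes "mero_fun \<phi>" and "mero_fun \<psi>"
  shows
    "(\<forall>D \<gamma>. disc D \<and> oriented_boundary D \<gamma> \<and>
        fun_regular_on \<phi> (cp1_topology frontier_of D) \<and>
        fun_regular_on \<psi> (cp1_topology frontier_of D) \<longrightarrow>
        (\<forall>x\<in>W_boundary D.
           Phi_disc D \<gamma> \<phi> (Phi_disc D \<gamma> \<psi> x) - Phi_disc D \<gamma> \<psi> (Phi_disc D \<gamma> \<phi> x) =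
           (- (1 / (2 * pi * \<i>) * form_integral \<gamma> (fun_times_form \<phi> (dcoeff \<psi>)))) *\<^sub>C x)) \<and>
     (\<forall>P x.
        Phi_right P \<phi> (Phi_right P \<psi> x) - Phi_right P \<psi> (Phi_right P \<phi> x) =
        Res P (fun_times_form \<phi> (dcoeff \<psi>)) *\<^sub>C x) \<and>
     (\<forall>Q x.
        Phi_left Q \<phi> (Phi_left Q \<psi> x) - Phi_left Q \<psi> (Phi_left Q \<phi> x) =
        (- Res Q (fun_times_form \<phi> (dcoeff \<psi>))) *\<^sub>C x)"
proof (intro conjI allI impI ballI)
  fix D \<gamma> x
  assume D: "disc D \<and> oriented_boundary D \<gamma> \<and>
        fun_regular_on \<phi> (cp1_topology frontier_of D) \<and>
        fun_regular_on \<psi> (cp1_topology frontier_of D)" and x: "x \<in> W_boundary D"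
  interpret oriented_disc D \<gamma> using D by unfold_locales auto
  show "Phi_disc D \<gamma> \<phi> (Phi_disc D \<gamma> \<psi> x) - Phi_disc D \<gamma> \<psi> (Phi_disc D \<gamma> \<phi> x) =
           (- (1 / (2 * pi * \<i>) * form_integral \<gamma> (fun_times_form \<phi> (dcoeff \<psi>)))) *\<^sub>C x"
    using Phi_disc_commutator assms D x by (simp add: F_def)
qed (intro Phi_right_commutator Phi_left_commutator assms)+

end
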